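(* Let $n\ge 5$ and let $G$ be a bicyclic graph on $n$ vertices. Then $ER(G)\le ER(Y_n)$, with equality if and only if $G\cong Y_n$.
   Context: All graphs are finite, simple and undirected. For a graph $G$ on $n$ vertices with adjacency eigenvalues $\lambda_1\ge\cdots\ge\lambda_n$, the resolvent energy is $ER(G)=\sum_{i=1}^n \frac{1}{n-\lambda_i}$. A bicyclic graph is a connected graph with $n$ vertices and $n+1$ edges. For positive integers $p,q,\ell$, $\theta(p,q,\ell)$ denotes the union of three internally disjoint paths with $p+1$, $q+1$ and $\ell+1$ vertices respectively, having the same two end vertices; thus $\theta(2,2,1)$ is the complete graph $K_4$ minus one edge. $Y_n$ denotes the bicyclic graph obtained from $\theta(2,2,1)$ by attaching $n-4$ pendent vertices to one of its vertices of degree $3$. *)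

theory Defs
  imports
    "Graph_Theory.Graph_Theory"
    "Jordan_Normal_Form.Char_Poly"
begin

text \<open>
  A finite simple undirected graph is a \<open>pair_graph\<close>: a finite vertex set with a symmetric
  irreflexive arc relation, so each undirected edge \<open>{u, v}\<close> is represented by the two arcs
  \<open>(u, v)\<close> and \<open>(v, u)\<close>.
\<close>

definition uedges :: "'a pair_pre_digraph \<Rightarrow> 'a set set" where
  "uedges G = (\<lambda>(u, v). {u, v}) ` parcs G"

definition bicyclic :: "'a pair_pre_digraph \<Rightarrow> bool" where
  "bicyclic G \<longleftrightarrow> pair_graph G \<and> Digraph_Component.connected (with_proj G)
     \<and> card (uedges G) = card (pverts G) + 1"

definition adjacency_matrix :: "'a pair_pre_digraph \<Rightarrow> 'a list \<Rightarrow> real mat" where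
  "adjacency_matrix G vs = mat (length vs) (length vs)
     (\<lambda>(i, j). if (vs ! i, vs ! j) \<in> parcs G then 1 else 0)"

text \<open>
  The multiset of adjacency eigenvalues, each with its multiplicity. The choice of the vertex
  enumeration is immaterial, see \<open>adj_spectrum_eq\<close> below, and no eigenvalue is lost by
  taking only real roots, see \<open>size_adj_spectrum\<close>.
\<close>

definition adj_spectrum :: "'a pair_pre_digraph \<Rightarrow> real multiset" where
  "adj_spectrum G =
     proots (char_poly (adjacency_matrix G (SOME vs. distinct vs \<and> set vs = pverts G)))"

definition resolvent_energy :: "'a pair_pre_digraph \<Rightarrow> real" where
  "resolvent_energy G = (\<Sum>x\<in>#adj_spectrum G. 1 / (real (card (pverts G)) - x))"

definition path_arcs :: "'a list \<Rightarrow> 'a rel" where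
  "path_arcs vs = set (zip vs (tl vs))"

text \<open>
  The common end vertices of the three paths are \<open>0\<close> and \<open>1\<close>; the inner vertices are
  numbered consecutively from \<open>2\<close>. The lengths should be positive and at most one of \<open>p\<close>, \<open>q\<close>, \<open>l\<close> equal to \<open>1\<close>.
\<close>

definition theta_graph :: "nat \<Rightarrow> nat \<Rightarrow> nat \<Rightarrow> nat pair_pre_digraph" where
  "theta_graph p q l = mk_symmetric (with_proj
     \<lparr> pverts = {0..<p + q + l - 1},
       parcs = path_arcs (0 # [2..<p + 1] @ [1])
             \<union> path_arcs (0 # [p + 1..<p + q] @ [1])
             \<union> path_arcs (0 # [p + q..<p + q + l - 1] @ [1]) \<rparr>)"

text \<open>\<open>S\<close> is the set of new pendent vertices; it should be disjoint from \<open>pverts G\<close>.\<close>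

definition attach_pendents :: "'a pair_pre_digraph \<Rightarrow> 'a \<Rightarrow> 'a set \<Rightarrow> 'a pair_pre_digraph" where
  "attach_pendents G v S = mk_symmetric (with_proj
     \<lparr> pverts = pverts G \<union> S, parcs = parcs G \<union> {v} \<times> S \<rparr>)"

text \<open>
  The graph \<open>theta_graph 2 2 1\<close> has vertices \<open>0, 1, 2, 3\<close>, of which \<open>0\<close> and \<open>1\<close> have degree \<open>3\<close>.
\<close>

definition Y_graph :: "nat \<Rightarrow> nat pair_pre_digraph" where
  "Y_graph n = attach_pendents (theta_graph 2 2 1) 0 {4..<n}"

lemma theta_graph_2_2_1:
  "pverts (theta_graph 2 2 1) = {0, 1, 2, 3}"
  "parcs (theta_graph 2 2 1) = {(u, v). u \<in> {0, 1, 2, 3} \<and> v \<in> {0, 1, 2, 3} \<and> u \<noteq> v} - {(2, 3), (3, 2)}"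
proof -
  have up: "[2..<2 + 1] = [2::nat]" "[2 + 1..<2 + 2] = [3::nat]" "[2 + 2..<2 + 2 + 1 - 1] = ([]::nat list)"
    by (simp_all add: upt_rec)
  show "pverts (theta_graph 2 2 1) = {0, 1, 2, 3}"
    by (auto simp: theta_graph_def mk_symmetric_def)
  show "parcs (theta_graph 2 2 1) = {(u, v). u \<in> {0, 1, 2, 3} \<and> v \<in> {0, 1, 2, 3} \<and> u \<noteq> v} - {(2, 3), (3, 2)}"
    unfolding theta_graph_def up by (auto simp: mk_symmetric_def path_arcs_def)
qed

lemmas theta_221 = theta_graph_2_2_1[unfolded One_nat_def]

lemma pverts_Y_graph: "4 \<le> n \<Longrightarrow> pverts (Y_graph n) = {0..<n}"
  by (auto simp: Y_graph_def attach_pendents_def mk_symmetric_def theta_221)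

lemma parcs_Y_graph:
  "parcs (Y_graph n) = parcs (theta_graph 2 2 1) \<union> {0} \<times> {4..<n} \<union> {4..<n} \<times> {0}"
proof -
  have "sym (parcs (theta_graph 2 2 1))"
    using symmetric_mk_symmetric unfolding theta_graph_def by (metis symmetric_def with_proj_simps(3))
  then have "(v, u) \<in> parcs (theta_graph 2 2 1)" if "(u, v) \<in> parcs (theta_graph 2 2 1)" for u v
    using that by (rule symD)
  then show ?thesis
    unfolding Y_graph_def attach_pendents_def parcs_mk_symmetric
    by (simp only: with_proj_simps pair_pre_digraph.simps) fastforce
qed

lemma pair_graph_Y_graph: "4 \<le> n \<Longrightarrow> pair_graph (Y_graph n)"
proof -
  assume n: "4 \<le> n"
  have sub: "parcs (Y_graph n) \<subseteq> {0..<n} \<times> {0..<n}"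
    using n by (auto simp: parcs_Y_graph theta_221)
  show ?thesis
  proof
    fix e assume e: "e \<in> parcs (Y_graph n)"
    then show "fst e \<in> pverts (Y_graph n)" "snd e \<in> pverts (Y_graph n)"
      using sub pverts_Y_graph[OF n] by (metis mem_Times_iff subsetD)+
    show "fst e \<noteq> snd e"
      using e unfolding parcs_Y_graph theta_graph_2_2_1 by auto
  next
    show "finite (pverts (Y_graph n))" by (simp add: pverts_Y_graph n)
    show "finite (parcs (Y_graph n))"
      using sub by (rule finite_subset) auto
    show "symmetric (with_proj (Y_graph n))"
      unfolding Y_graph_def attach_pendents_def by (rule symmetric_mk_symmetric)
  qed
qed

lemma bicyclic_Y_graph:
  assumes n: "4 \<le> n" shows "bicyclic (Y_graph n)"
proof -
  interpret pair_graph "Y_graph n" using n by (rule pair_graph_Y_graph)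
  have zero: "0 \<rightarrow>\<^sup>*\<^bsub>with_proj (Y_graph n)\<^esub> v \<and> v \<rightarrow>\<^sup>*\<^bsub>with_proj (Y_graph n)\<^esub> 0" if "v \<in> {0..<n}" for v
  proof (cases "v = 0")
    case True
    then show ?thesis using n by (auto simp: pverts_Y_graph)
  next
    case False
    then have "(0, v) \<in> parcs (Y_graph n)" "(v, 0) \<in> parcs (Y_graph n)"
      using that by (auto simp: parcs_Y_graph theta_221)
    then show ?thesis by (auto intro: reachable_adjI)
  qed
  have "strongly_connected (with_proj (Y_graph n))"
    unfolding strongly_connected_def
  proof (intro conjI ballI)
    show "verts (with_proj (Y_graph n)) \<noteq> {}" using n by (auto simp: pverts_Y_graph)
    fix u v assume "u \<in> verts (with_proj (Y_graph n))" "v \<in> verts (with_proj (Y_graph n))"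
    then show "u \<rightarrow>\<^sup>*\<^bsub>with_proj (Y_graph n)\<^esub> v"
      using zero[of u] zero[of v] n reachable_trans by (auto simp: pverts_Y_graph)
  qed
  then have conn: "Digraph_Component.connected (with_proj (Y_graph n))"
    unfolding connected_def strongly_connected_def
    by (simp add: reachable_mk_symmetric_eq[OF sym_arcs])
  have "uedges (Y_graph n) = (\<lambda>v. {0, v}) ` {1..<n} \<union> {{1, 2}, {1, 3}}"
  proof -
    have th: "parcs (theta_graph 2 2 1) =
        {(0, 1), (1, 0), (0, 2), (2, 0), (0, 3), (3, 0), (1, 2), (2, 1), (1, 3), (3, 1)}"
      unfolding theta_graph_2_2_1 by auto
    have "{1..<n} = {1, 2, 3} \<union> {4..<n}" using n by auto
    then have "(\<lambda>v. {0, v}) ` {1..<n} = {{0, 1}, {0, 2}, {0, 3}} \<union> (\<lambda>v. {0, v}) ` {4..<n}"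
      by (simp only: image_Un image_insert image_empty)
    moreover have "(\<lambda>(u, v). {u, v}) ` ({0} \<times> {4..<n}) = (\<lambda>v. {0, v}) ` {4..<n}"
      "(\<lambda>(u, v). {u, v}) ` ({4..<n} \<times> {0}) = (\<lambda>v. {0, v}) ` {4..<n}"
      by (force simp: image_iff insert_commute)+
    ultimately show ?thesis
      unfolding uedges_def parcs_Y_graph th image_Un image_insert image_empty
      by (simp add: insert_commute Un_commute Un_left_commute)
  qed
  moreover have "card ((\<lambda>v. {0, v}) ` {1..<n}) = n - 1"
    by (subst card_image) (auto simp: inj_on_def doubleton_eq_iff)
  moreover have "card ((\<lambda>v. {0, v}) ` {1..<n} \<union> {{1, 2}, {1, 3}}) =
      card ((\<lambda>v. {0, v}) ` {1..<n}) + card {{1, 2}, {1, 3::nat}}"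
    by (rule card_Un_disjoint) (auto simp: doubleton_eq_iff)
  moreover have "card {{1, 2}, {1, 3::nat}} = 2" by (auto simp: doubleton_eq_iff card_insert_if)
  ultimately have "card (uedges (Y_graph n)) = n + 1" using n by simp
  then show ?thesis
    using conn pair_graph_Y_graph[OF n] n by (simp add: bicyclic_def pverts_Y_graph)
qed

lemma adjacency_matrix_carrier [simp]: "adjacency_matrix G vs \<in> carrier_mat (length vs) (length vs)"
  by (simp add: adjacency_matrix_def)

lemma char_poly_adjacency_matrix_cong:
  assumes vs: "distinct vs" and ws: "distinct ws" and eq: "set vs = set ws"
  shows "char_poly (adjacency_matrix G vs) = char_poly (adjacency_matrix G ws)"
proof (rule char_poly_similar)
  define n where "n = length vs"
  have len: "length vs = n" "length ws = n"
    using distinct_card[OF vs] distinct_card[OF ws] eq by (simp_all add: n_def)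
  define f where "f i = (THE k. k < n \<and> ws ! k = vs ! i)" for i
  have ex: "\<exists>!k. k < n \<and> ws ! k = vs ! i" if "i < n" for i
  proof -
    have "vs ! i \<in> set ws" using that len eq by (metis nth_mem)
    then obtain k where "k < n" "ws ! k = vs ! i" using len by (auto simp: in_set_conv_nth)
    then show ?thesis using nth_eq_iff_index_eq[OF ws] len by metis
  qed
  have f: "f i < n" "ws ! f i = vs ! i" if "i < n" for i
    using theI'[OF ex[OF that]] by (auto simp: f_def)
  have inj: "inj_on f {0..<n}"
  proof (rule inj_onI)
    fix i j assume "i \<in> {0..<n}" "j \<in> {0..<n}" "f i = f j"
    then have "i < n" "j < n" "vs ! i = vs ! j" using f(2)[of i] f(2)[of j] by simp_all
    then show "i = j" using nth_eq_iff_index_eq[OF vs] len by blast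
  qed
  define P :: "real mat" where "P = mat n n (\<lambda>(i, j). if j = f i then 1 else 0)"
  define Q :: "real mat" where "Q = mat n n (\<lambda>(j, i). if j = f i then 1 else 0)"
  have A: "adjacency_matrix G vs \<in> carrier_mat n n" "adjacency_matrix G ws \<in> carrier_mat n n"
    using adjacency_matrix_carrier[of G vs] adjacency_matrix_carrier[of G ws] len by simp_all
  have PQ: "P \<in> carrier_mat n n" "Q \<in> carrier_mat n n" by (auto simp: P_def Q_def)
  have 1: "P * Q = 1\<^sub>m n"
  proof (rule eq_matI)
    fix i j assume ij: "i < dim_row (1\<^sub>m n)" "j < dim_col (1\<^sub>m n)"
    then have "(P * Q) $$ (i, j) = (\<Sum>k\<in>{0..<n}. (if k = f i then 1 else 0) * (if k = f j then 1 else 0))"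
      by (simp add: P_def Q_def scalar_prod_def)
    also have "\<dots> = (\<Sum>k\<in>{0..<n}. if k = f i then (if f i = f j then 1 else 0) else 0)"
      by (intro sum.cong) auto
    also have "\<dots> = (if f i = f j then 1 else 0)" using f[of i] ij by (simp add: sum.delta)
    also have "\<dots> = 1\<^sub>m n $$ (i, j)" using inj ij by (auto simp: inj_on_def)
    finally show "(P * Q) $$ (i, j) = 1\<^sub>m n $$ (i, j)" .
  qed (auto simp: P_def Q_def)
  have 2: "Q * P = 1\<^sub>m n" by (rule mat_mult_left_right_inverse[OF PQ 1])
  have 3: "adjacency_matrix G vs = P * adjacency_matrix G ws * Q"
  proof (rule eq_matI)
    fix i j assume "i < dim_row (P * adjacency_matrix G ws * Q)" "j < dim_col (P * adjacency_matrix G ws * Q)"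
    then have ij: "i < n" "j < n" using PQ by auto
    have PA: "(P * adjacency_matrix G ws) $$ (i, k) = adjacency_matrix G ws $$ (f i, k)" if k: "k < n" for k
    proof -
      have "(P * adjacency_matrix G ws) $$ (i, k) = (\<Sum>m\<in>{0..<n}. (if m = f i then 1 else 0) * adjacency_matrix G ws $$ (m, k))"
        using ij k A by (simp add: P_def scalar_prod_def)
      also have "\<dots> = (\<Sum>m\<in>{0..<n}. if m = f i then adjacency_matrix G ws $$ (f i, k) else 0)"
        by (intro sum.cong) auto
      also have "\<dots> = adjacency_matrix G ws $$ (f i, k)" using f[of i] ij by (simp add: sum.delta)
      finally show ?thesis .
    qed
    have "(P * adjacency_matrix G ws * Q) $$ (i, j)
        = (\<Sum>k\<in>{0..<n}. (P * adjacency_matrix G ws) $$ (i, k) * Q $$ (k, j))"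
    proof -
      have "P * adjacency_matrix G ws \<in> carrier_mat n n" using A PQ by simp
      then show ?thesis
        using ij PQ by (subst index_mult_mat(1)) (auto simp: scalar_prod_def simp del: assoc_mult_mat intro!: sum.cong)
    qed
    also have "\<dots> = (\<Sum>k\<in>{0..<n}. if k = f j then adjacency_matrix G ws $$ (f i, f j) else 0)"
      by (intro sum.cong) (use ij in \<open>auto simp: PA Q_def\<close>)
    also have "\<dots> = adjacency_matrix G ws $$ (f i, f j)" using f[of j] ij by (simp add: sum.delta)
    also have "\<dots> = adjacency_matrix G vs $$ (i, j)" using f ij len by (simp add: adjacency_matrix_def)
    finally show "adjacency_matrix G vs $$ (i, j) = (P * adjacency_matrix G ws * Q) $$ (i, j)" by simp
  qed (use A PQ in auto)
  show "similar_mat (adjacency_matrix G vs) (adjacency_matrix G ws)"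
    by (rule similar_matI[of _ _ P Q n]) (use A PQ 1 2 3 in auto)
qed

lemma adj_spectrum_eq:
  assumes "distinct vs" "set vs = pverts G"
  shows "adj_spectrum G = proots (char_poly (adjacency_matrix G vs))"
proof -
  let ?ws = "SOME ws. distinct ws \<and> set ws = pverts G"
  have "distinct ?ws \<and> set ?ws = pverts G"
    by (rule someI[of _ vs]) (use assms in simp)
  then show ?thesis
    unfolding adj_spectrum_def using assms char_poly_adjacency_matrix_cong[of ?ws vs G] by simp
qed

lemma map_poly_real_splits:
  fixes p :: "real poly"
  assumes "p \<noteq> 0" and "\<And>z. poly (map_poly complex_of_real p) z = 0 \<Longrightarrow> z \<in> \<real>"
  shows "size (proots p) = degree p"
  using assms
proof (induction "degree p" arbitrary: p)
  case 0
  then obtain c where "p = [:c:]" by (metis degree_eq_zeroE)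
  then show ?case by simp
next
  case (Suc d)
  have "degree (map_poly complex_of_real p) = Suc d"
    using Suc.hyps(2) by (simp add: degree_map_poly)
  then have "\<not> constant (poly (map_poly complex_of_real p))"
    by (simp add: constant_degree)
  then obtain z where z: "poly (map_poly complex_of_real p) z = 0"
    using fundamental_theorem_of_algebra by blast
  then obtain x where x: "z = complex_of_real x" using Suc.prems(2) by (auto elim: Reals_cases)
  then have "poly p x = 0" using z by (simp add: of_real_hom.poly_map_poly)
  then obtain q where q: "p = [:- x, 1:] * q" by (auto simp: poly_eq_0_iff_dvd elim: dvdE)
  then have q0: "q \<noteq> 0" using Suc.prems(1) by auto
  have deg: "degree p = Suc (degree q)" unfolding q using q0 by (subst degree_mult_eq) auto
  have "poly (map_poly complex_of_real p) w = 0" if "poly (map_poly complex_of_real q) w = 0" for w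
  proof -
    interpret map_poly_comm_ring_hom complex_of_real ..
    show ?thesis unfolding q hom_mult using that by simp
  qed
  then have "size (proots q) = degree q" using Suc.hyps Suc.prems(2) q0 deg by simp
  moreover have "proots p = proots [:- x, 1:] + proots q"
    unfolding q using q0 by (intro proots_mult) auto
  moreover have "proots [:- x, 1:] = {#x#}"
    using proots_linear_factor[of x] by simp
  ultimately show ?case using deg by simp
qed

lemma real_symmetric_root_real:
  fixes A :: "real mat"
  assumes A: "A \<in> carrier_mat n n"
    and sym: "\<And>i j. i < n \<Longrightarrow> j < n \<Longrightarrow> A $$ (i, j) = A $$ (j, i)"
    and root: "poly (map_poly complex_of_real (char_poly A)) z = 0"
  shows "z \<in> \<real>"
proof -
  let ?C = "map_mat complex_of_real A"
  have C: "?C \<in> carrier_mat n n" using A by simp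
  have "eigenvalue ?C z"
    using root eigenvalue_root_char_poly[OF C] by (simp add: of_real_hom.char_poly_hom[OF A])
  then obtain v where v: "v \<in> carrier_vec n" "v \<noteq> 0\<^sub>v n" and ev: "?C *\<^sub>v v = z \<cdot>\<^sub>v v"
    using A by (auto simp: eigenvalue_def eigenvector_def)
  have row: "(\<Sum>j<n. complex_of_real (A $$ (i, j)) * v $ j) = z * v $ i" if i: "i < n" for i
  proof -
    have "(?C *\<^sub>v v) $ i = (\<Sum>j<n. complex_of_real (A $$ (i, j)) * v $ j)"
      using i A v by (auto simp: scalar_prod_def lessThan_atLeast0 intro!: sum.cong)
    then show ?thesis using ev i v by simp
  qed
  define S where "S = (\<Sum>i<n. \<Sum>j<n. cnj (v $ i) * (complex_of_real (A $$ (i, j)) * v $ j))"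
  define N where "N = (\<Sum>i<n. (cmod (v $ i))\<^sup>2)"
  have "S = (\<Sum>i<n. cnj (v $ i) * (z * v $ i))"
    unfolding S_def by (intro sum.cong refl) (simp add: row flip: sum_distrib_left)
  also have "\<dots> = z * (\<Sum>i<n. v $ i * cnj (v $ i))"
    by (simp add: sum_distrib_left mult_ac)
  also have "(\<Sum>i<n. v $ i * cnj (v $ i)) = complex_of_real N"
    unfolding N_def of_real_sum by (intro sum.cong refl) (simp only: complex_norm_square)
  finally have S: "S = z * complex_of_real N" .
  have "cnj S = (\<Sum>i<n. \<Sum>j<n. v $ i * (complex_of_real (A $$ (i, j)) * cnj (v $ j)))"
    by (simp add: S_def)
  also have "\<dots> = (\<Sum>j<n. \<Sum>i<n. v $ i * (complex_of_real (A $$ (i, j)) * cnj (v $ j)))"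
    by (rule sum.swap)
  also have "\<dots> = S"
    unfolding S_def by (intro sum.cong refl) (use sym in \<open>simp add: mult_ac\<close>)
  finally have "cnj z * complex_of_real N = z * complex_of_real N" by (simp add: S)
  moreover obtain i where i: "i < n" "v $ i \<noteq> 0"
    using v by (metis carrier_vecD eq_vecI index_zero_vec(1) index_zero_vec(2))
  have "N > 0" unfolding N_def
    by (rule sum_pos2[of _ i]) (use i in auto)
  ultimately have "cnj z = z" by simp
  then show ?thesis by (simp add: Reals_cnj_iff)
qed

lemma size_adj_spectrum:
  assumes "pair_graph G"
  shows "size (adj_spectrum G) = card (pverts G)"
proof -
  interpret pair_graph G by fact
  obtain vs where vs: "distinct vs" "set vs = pverts G"
    using finite_distinct_list[OF pair_finite_verts] by blast
  let ?A = "adjacency_matrix G vs"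
  have dm: "degree (char_poly ?A) = length vs \<and> coeff (char_poly ?A) (length vs) = 1"
    by (rule degree_monic_char_poly) simp
  have sym: "(u, v) \<in> parcs G \<longleftrightarrow> (v, u) \<in> parcs G" for u v
    using pair_sym_arcs by (auto simp: symmetric_def sym_def)
  have "size (proots (char_poly ?A)) = degree (char_poly ?A)"
  proof (rule map_poly_real_splits)
    show "char_poly ?A \<noteq> 0" using dm by auto
    show "z \<in> \<real>" if "poly (map_poly complex_of_real (char_poly ?A)) z = 0" for z
      by (rule real_symmetric_root_real[OF adjacency_matrix_carrier _ that])
         (auto simp: adjacency_matrix_def sym)
  qed
  then show ?thesis
    using dm vs distinct_card[OF vs(1)] by (simp add: adj_spectrum_eq[OF vs])
qed

end

theory Submission
  imports Defs "Jordan_Normal_Form.Schur_Decomposition"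
begin

text \<open>
  The Kelmans transformation moves the private neighbours of \<open>v\<close> over to \<open>u\<close>. In the basis
  obtained by replacing \<open>e\<^sub>u, e\<^sub>v\<close> by \<open>e\<^sub>u + e\<^sub>v, e\<^sub>u - e\<^sub>v\<close> it turns \<open>A + I\<close>, where \<open>A\<close> is the
  adjacency matrix, into its entrywise absolute value. Hence it does not decrease any of the traces of
  \<open>(A + I)\<^sup>k\<close>, and it increases the one for \<open>k = 4\<close> if \<open>u\<close> and \<open>v\<close> both have private neighbours. Since
  \<open>ER(G)\<close> is the sum of \<open>tr((A + I)\<^sup>k) / (n + 1)\<^sup>k\<^sup>+\<^sup>1\<close> over all \<open>k\<close>, the transformation then strictly
  increases the resolvent energy. It keeps a bicyclic graph bicyclic if \<open>u\<close> and \<open>v\<close> are adjacent or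
  have a common neighbour. So in a bicyclic graph of maximal resolvent energy any two such vertices
  have nested neighbourhoods. This forces a vertex of maximal degree to be adjacent to all others,
  and the two remaining edges to share an end vertex, which is the graph \<open>Y\<^sub>n\<close>.
\<close>

section \<open>Traces of matrix powers\<close>

definition mat_trace :: "'a :: comm_monoid_add mat \<Rightarrow> 'a" where
  "mat_trace A = (\<Sum>i<dim_row A. A $$ (i, i))"

lemma index_mult_mat_sum:
  assumes "A \<in> carrier_mat n m" "B \<in> carrier_mat m l" "i < n" "j < l"
  shows "(A * B) $$ (i, j) = (\<Sum>k<m. A $$ (i, k) * B $$ (k, j))"
  using assms by (auto simp: scalar_prod_def lessThan_atLeast0)

lemma mat_trace_mult_commute:
  fixes A B :: "'a :: comm_semiring_1 mat"
  assumes "A \<in> carrier_mat n n" "B \<in> carrier_mat n n"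
  shows "mat_trace (A * B) = mat_trace (B * A)"
proof -
  have "mat_trace (A * B) = (\<Sum>i<n. \<Sum>k<n. A $$ (i, k) * B $$ (k, i))"
    using assms by (auto simp: mat_trace_def index_mult_mat_sum[OF assms] simp del: index_mult_mat(1))
  also have "\<dots> = (\<Sum>k<n. \<Sum>i<n. B $$ (k, i) * A $$ (i, k))"
    by (subst sum.swap) (simp add: mult.commute)
  also have "\<dots> = mat_trace (B * A)"
    using assms by (auto simp: mat_trace_def index_mult_mat_sum[OF assms(2,1)] simp del: index_mult_mat(1))
  finally show ?thesis .
qed

lemma mat_trace_similar_pow:
  fixes A B :: "'a :: comm_ring_1 mat"
  assumes "similar_mat_wit A B P Q"
  shows "mat_trace (A ^\<^sub>m k) = mat_trace (B ^\<^sub>m k)"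
proof -
  define n where "n = dim_row A"
  have A: "A \<in> carrier_mat n n" and B: "B \<in> carrier_mat n n"
    using similar_mat_witD[OF n_def assms] by auto
  have P: "P \<in> carrier_mat n n" and Q: "Q \<in> carrier_mat n n" and QP: "Q * P = 1\<^sub>m n"
    using similar_mat_witD[OF n_def assms] by auto
  have "A ^\<^sub>m k = P * B ^\<^sub>m k * Q" by (rule similar_mat_wit_pow_id[OF assms])
  also have "\<dots> = P * (B ^\<^sub>m k * Q)"
    using P Q B by (simp add: assoc_mult_mat[of _ n n _ n _ n])
  finally have "mat_trace (A ^\<^sub>m k) = mat_trace (P * (B ^\<^sub>m k * Q))" by simp
  also have "\<dots> = mat_trace ((B ^\<^sub>m k * Q) * P)"
    by (rule mat_trace_mult_commute[of _ n]) (use P Q B in auto)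
  also have "(B ^\<^sub>m k * Q) * P = B ^\<^sub>m k"
    using P Q B QP by (simp add: assoc_mult_mat[of _ n n _ n _ n])
  finally show ?thesis .
qed

text \<open>The two claims are proved together: in the sum for the diagonal entry at
  \<open>i\<close>, the terms with \<open>l < i\<close> vanish by the first claim for
  \<open>k\<close>, and those with \<open>l > i\<close> because \<open>C\<close> is
  triangular.\<close>

lemma upper_triangular_pow:
  fixes C :: "'a :: comm_ring_1 mat"
  assumes C: "C \<in> carrier_mat n n" and "upper_triangular C"
  shows "(\<forall>i<n. \<forall>j<i. (C ^\<^sub>m k) $$ (i, j) = 0) \<and> (\<forall>i<n. (C ^\<^sub>m k) $$ (i, i) = (C $$ (i, i)) ^ k)"
proof (induction k)
  case 0
  then show ?case using C by auto
next
  case (Suc k)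
  have up: "C $$ (i, j) = 0" if "j < i" "i < n" for i j
    using assms that by auto
  have Ck: "C ^\<^sub>m k \<in> carrier_mat n n" using C by simp
  have idx: "(C ^\<^sub>m Suc k) $$ (i, j) = (\<Sum>l<n. (C ^\<^sub>m k) $$ (i, l) * C $$ (l, j))" if "i < n" "j < n" for i j
    using index_mult_mat_sum[OF Ck C that] by simp
  have "(C ^\<^sub>m Suc k) $$ (i, j) = 0" if "j < i" "i < n" for i j
  proof -
    have "(C ^\<^sub>m k) $$ (i, l) * C $$ (l, j) = 0" if "l < n" for l
      using Suc.IH up[of j l] \<open>j < i\<close> \<open>i < n\<close> that by (cases "l < i") auto
    then show ?thesis using that by (simp add: idx del: pow_mat.simps)
  qed
  moreover have "(C ^\<^sub>m Suc k) $$ (i, i) = (C $$ (i, i)) ^ Suc k" if i: "i < n" for i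
  proof -
    have "(C ^\<^sub>m k) $$ (i, l) * C $$ (l, i) = (if l = i then (C $$ (i, i)) ^ k * C $$ (i, i) else 0)"
      if "l < n" for l
      using Suc.IH up[of i l] i that by (cases l i rule: linorder_cases) auto
    then have "(\<Sum>l<n. (C ^\<^sub>m k) $$ (i, l) * C $$ (l, i))
        = (\<Sum>l<n. if l = i then (C $$ (i, i)) ^ k * C $$ (i, i) else 0)"
      by (intro sum.cong) auto
    then show ?thesis using i by (simp add: idx mult.commute del: pow_mat.simps(2))
  qed
  ultimately show ?case by blast
qed

text \<open>A Schur triangularisation of \<open>A\<close> with diagonal \<open>es\<close> also
  triangularises \<open>A\<close> plus the identity, since conjugation fixes the identity. The
  diagonal then consists of the values \<open>e + 1\<close>, and similarity preserves the
  trace.\<close>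

lemma mat_trace_shift_pow:
  fixes A :: "'a :: conjugatable_ordered_field mat"
  assumes A: "A \<in> carrier_mat n n" and es: "char_poly A = (\<Prod>e\<leftarrow>es. [:- e, 1:])"
  shows "mat_trace ((A + 1\<^sub>m n) ^\<^sub>m k) = (\<Sum>e\<leftarrow>es. (e + 1) ^ k)"
proof -
  obtain B P Q where BPQ: "schur_decomposition A es = (B, P, Q)" by (metis prod_cases3)
  then have sim: "similar_mat_wit A B P Q" and up: "upper_triangular B" and dg: "diag_mat B = es"
    using schur_decomposition[OF A es] by auto
  note D = similar_mat_witD2[OF A sim]
  have "P * (B + 1\<^sub>m n) * Q = P * B * Q + P * Q"
    using D(4-7) by (simp add: mult_add_distrib_mat[of _ n n _ n] add_mult_distrib_mat[of _ n n _ _ n])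
  then have "A + 1\<^sub>m n = P * (B + 1\<^sub>m n) * Q" using D by simp
  then have sim': "similar_mat_wit (A + 1\<^sub>m n) (B + 1\<^sub>m n) P Q"
    using D A by (intro similar_mat_witI[of _ _ n]) auto
  have C: "B + 1\<^sub>m n \<in> carrier_mat n n" using D by auto
  have up': "upper_triangular (B + 1\<^sub>m n)"
    using upper_triangularD[OF up] D(5) by (intro upper_triangularI) auto
  have "mat_trace ((A + 1\<^sub>m n) ^\<^sub>m k) = mat_trace ((B + 1\<^sub>m n) ^\<^sub>m k)"
    by (rule mat_trace_similar_pow[OF sim'])
  also have "\<dots> = (\<Sum>i<n. (B $$ (i, i) + 1) ^ k)"
    using upper_triangular_pow[OF C up'] C D(5) by (simp add: mat_trace_def)
  also have "\<dots> = (\<Sum>e\<leftarrow>es. (e + 1) ^ k)"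
    using D(5) by (simp add: dg[symmetric] diag_mat_def interv_sum_list_conv_sum_set_nat lessThan_atLeast0 o_def)
  finally show ?thesis .
qed

text \<open>Bridges two forms of the spectrum: \<open>adj_spectrum\<close> is a multiset of roots,
  whereas the Schur decomposition asks for a product of linear factors. With as many roots as the
  degree, dividing all of them out leaves the constant 1.\<close>

lemma monic_split_proots:
  fixes p :: "'a :: field poly"
  assumes "size (proots p) = degree p" "lead_coeff p = 1" "mset es = proots p"
  shows "p = (\<Prod>e\<leftarrow>es. [:- e, 1:])"
  using assms
proof (induction es arbitrary: p)
  case Nil
  then have "degree p = 0" by simp
  then show ?case using Nil.prems(2) by (metis degree_eq_zeroE lead_coeff_pCons(2) list.simps(8) pCons_one prod_list.Nil)
next
  case (Cons x es)
  have p0: "p \<noteq> 0" using Cons.prems(2) by auto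
  have "x \<in># proots p" using Cons.prems(3) by (metis list.set_intros(1) set_mset_mset)
  then have "poly p x = 0" using p0 by simp
  then obtain q where q: "p = [:- x, 1:] * q" by (auto simp: poly_eq_0_iff_dvd elim: dvdE)
  then have q0: "q \<noteq> 0" using p0 by auto
  have deg: "degree p = Suc (degree q)" unfolding q using q0 by (subst degree_mult_eq) auto
  have "proots p = proots [:- x, 1:] + proots q"
    unfolding q using q0 by (intro proots_mult) auto
  then have "proots p = add_mset x (proots q)" using proots_linear_factor[of "- x"] by simp
  then have "mset es = proots q" "size (proots q) = degree q" using Cons.prems(1,3) deg by auto
  moreover have "lead_coeff q = 1" using Cons.prems(2) unfolding q lead_coeff_mult by simp
  ultimately show ?case using Cons.IH[of q] q by simp
qed

section \<open>Entrywise domination of matrices\<close>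

lemma abs_mult_mat_le:
  fixes A B C D :: "real mat"
  assumes "A \<in> carrier_mat n n" "B \<in> carrier_mat n n" "C \<in> carrier_mat n n" "D \<in> carrier_mat n n"
    and "\<And>i j. i < n \<Longrightarrow> j < n \<Longrightarrow> \<bar>A $$ (i, j)\<bar> \<le> C $$ (i, j)"
    and "\<And>i j. i < n \<Longrightarrow> j < n \<Longrightarrow> \<bar>B $$ (i, j)\<bar> \<le> D $$ (i, j)"
    and ij: "i < n" "j < n"
  shows "\<bar>(A * B) $$ (i, j)\<bar> \<le> (C * D) $$ (i, j)"
proof -
  have "\<bar>\<Sum>k<n. A $$ (i, k) * B $$ (k, j)\<bar> \<le> (\<Sum>k<n. \<bar>A $$ (i, k) * B $$ (k, j)\<bar>)"
    by (rule sum_abs)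
  also have "\<dots> \<le> (\<Sum>k<n. C $$ (i, k) * D $$ (k, j))"
    using assms by (intro sum_mono) (auto simp: abs_mult intro!: mult_mono order_trans[OF abs_ge_zero])
  finally show ?thesis
    using assms by (simp add: index_mult_mat_sum[of _ n n _ n] del: index_mult_mat(1))
qed

lemma abs_pow_mat_le:
  fixes A C :: "real mat"
  assumes A: "A \<in> carrier_mat n n" and C: "C \<in> carrier_mat n n"
    and le: "\<And>i j. i < n \<Longrightarrow> j < n \<Longrightarrow> \<bar>A $$ (i, j)\<bar> \<le> C $$ (i, j)"
    and ij: "i < n" "j < n"
  shows "\<bar>(A ^\<^sub>m k) $$ (i, j)\<bar> \<le> (C ^\<^sub>m k) $$ (i, j)"
  using ij
proof (induction k arbitrary: i j)
  case 0
  then show ?case using A C by auto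
next
  case (Suc k)
  show ?case
    using abs_mult_mat_le[of "A ^\<^sub>m k" n A "C ^\<^sub>m k" C i j] A C le Suc by simp
qed

section \<open>Symmetric and antisymmetric coordinates on the first two indices\<close>

definition pair_basis :: "nat \<Rightarrow> real mat" where
  "pair_basis n = mat n n (\<lambda>(i, j). if i = 1 \<and> j = 1 then -1
     else if i = j \<or> i + j = 1 then 1 else 0)"

text \<open>The top left block of \<open>pair_basis\<close> is \<open>[[1, 1], [1, -1]]\<close>,
  whose square is twice the identity; hence the inverse has the same block halved. For natural
  numbers, \<open>i + j = 1\<close> singles out the positions (0, 1) and (1, 0).\<close>

definition pair_basis_inv :: "nat \<Rightarrow> real mat" where
  "pair_basis_inv n = mat n n (\<lambda>(i, j). if i = 1 \<and> j = 1 then -1/2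
     else if i = 0 \<and> j = 0 \<or> i + j = 1 then 1/2 else if i = j then 1 else 0)"

lemma sum_lessThan_split2:
  fixes f :: "nat \<Rightarrow> 'a :: comm_monoid_add"
  assumes "2 \<le> n" shows "(\<Sum>k<n. f k) = f 0 + (f 1 + (\<Sum>k=2..<n. f k))"
proof -
  have "{..<n} = insert 0 (insert 1 {2..<n})" using assms by auto
  then show ?thesis by simp
qed

lemma mult_pair_basis:
  fixes A :: "real mat"
  assumes A: "A \<in> carrier_mat n n" and n: "2 \<le> n" and ij: "i < n" "j < n"
  shows "(A * pair_basis n) $$ (i, j) =
    (if j = 0 then A $$ (i, 0) + A $$ (i, 1) else if j = 1 then A $$ (i, 0) - A $$ (i, 1) else A $$ (i, j))"
proof -
  have T: "pair_basis n \<in> carrier_mat n n" by (simp add: pair_basis_def)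
  have "(\<Sum>k=2..<n. A $$ (i, k) * pair_basis n $$ (k, j)) = (\<Sum>k=2..<n. if k = j then A $$ (i, j) else 0)"
    using ij by (intro sum.cong) (auto simp: pair_basis_def)
  then show ?thesis
    using ij n by (simp add: index_mult_mat_sum[OF A T] sum_lessThan_split2 sum.delta' del: index_mult_mat(1))
      (auto simp: pair_basis_def)
qed

lemma pair_basis_mult:
  fixes A :: "real mat"
  assumes A: "A \<in> carrier_mat n n" and n: "2 \<le> n" and ij: "i < n" "j < n"
  shows "(pair_basis n * A) $$ (i, j) =
    (if i = 0 then A $$ (0, j) + A $$ (1, j) else if i = 1 then A $$ (0, j) - A $$ (1, j) else A $$ (i, j))"
proof -
  have T: "pair_basis n \<in> carrier_mat n n" by (simp add: pair_basis_def)
  have "(\<Sum>k=2..<n. pair_basis n $$ (i, k) * A $$ (k, j)) = (\<Sum>k=2..<n. if k = i then A $$ (i, j) else 0)"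
    using ij by (intro sum.cong) (auto simp: pair_basis_def)
  then show ?thesis
    using ij n by (simp add: index_mult_mat_sum[OF T A] sum_lessThan_split2 sum.delta' del: index_mult_mat(1))
      (auto simp: pair_basis_def)
qed

text \<open>\<open>pair_mat n A\<close> is \<open>A\<close> written in the basis \<open>e\<^sub>0 + e\<^sub>1, e\<^sub>0 - e\<^sub>1, e\<^sub>2, e\<^sub>3, \<dots>\<close>.\<close>

definition pair_mat :: "nat \<Rightarrow> real mat \<Rightarrow> real mat" where
  "pair_mat n A = mat n n (\<lambda>(i, j).
     let r = (\<lambda>i. if j = 0 then A $$ (i, 0) + A $$ (i, 1) else if j = 1 then A $$ (i, 0) - A $$ (i, 1) else A $$ (i, j))
     in if i = 0 then (r 0 + r 1) / 2 else if i = 1 then (r 0 - r 1) / 2 else r i)"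

text \<open>Instead of conjugating by the inverse, the products \<open>?T * ?M\<close> and
  \<open>A * ?T\<close> are compared entrywise; both involve only sums and differences over the
  indices 0 and 1.\<close>

lemma similar_pair_mat:
  fixes A :: "real mat"
  assumes A: "A \<in> carrier_mat n n" and n: "2 \<le> n"
  shows "similar_mat_wit A (pair_mat n A) (pair_basis n) (pair_basis_inv n)"
proof -
  let ?T = "pair_basis n" and ?S = "pair_basis_inv n" and ?M = "pair_mat n A"
  have c: "?T \<in> carrier_mat n n" "?S \<in> carrier_mat n n" "?M \<in> carrier_mat n n"
    by (auto simp: pair_basis_def pair_basis_inv_def pair_mat_def)
  have TS: "?T * ?S = 1\<^sub>m n"
  proof (rule eq_matI)
    fix i j assume "i < dim_row (1\<^sub>m n)" "j < dim_col (1\<^sub>m n)"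
    then have ij: "i < n" "j < n" by simp_all
    show "(?T * ?S) $$ (i, j) = 1\<^sub>m n $$ (i, j)"
      unfolding pair_basis_mult[OF c(2) n ij] using ij n by (auto simp: pair_basis_inv_def)
  qed (use c in auto)
  have ST: "?S * ?T = 1\<^sub>m n" by (rule mat_mult_left_right_inverse[OF c(1,2) TS])
  have "?T * ?M = A * ?T"
  proof (rule eq_matI)
    fix i j assume "i < dim_row (A * ?T)" "j < dim_col (A * ?T)"
    then have ij: "i < n" "j < n" using A c by simp_all
    show "(?T * ?M) $$ (i, j) = (A * ?T) $$ (i, j)"
      unfolding pair_basis_mult[OF c(3) n ij] mult_pair_basis[OF A n ij]
      using ij n by (simp add: pair_mat_def Let_def field_simps)
  qed (use c A in auto)
  then have "?T * ?M * ?S = A * ?T * ?S" by simp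
  also have "\<dots> = A" using A c TS by (simp add: assoc_mult_mat[of _ n n _ n _ n])
  finally show ?thesis using A c TS ST by (intro similar_mat_witI[of _ _ n]) auto
qed

text \<open>The hypotheses make \<open>pair_mat n B\<close> the entrywise absolute value of \<open>pair_mat n A\<close>.\<close>

lemma trace_pow_le_compress:
  fixes A B :: "real mat"
  assumes A: "A \<in> carrier_mat n n" and B: "B \<in> carrier_mat n n" and n: "2 \<le> n"
    and symA: "\<And>i j. i < n \<Longrightarrow> j < n \<Longrightarrow> A $$ (i, j) = A $$ (j, i)"
    and symB: "\<And>i j. i < n \<Longrightarrow> j < n \<Longrightarrow> B $$ (i, j) = B $$ (j, i)"
    and nonneg: "\<And>i j. i < n \<Longrightarrow> j < n \<Longrightarrow> 0 \<le> A $$ (i, j)"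
    and top: "A $$ (0, 0) = A $$ (1, 1)" "A $$ (0, 1) \<le> A $$ (0, 0)"
      "B $$ (0, 0) = A $$ (0, 0)" "B $$ (1, 1) = A $$ (1, 1)" "B $$ (0, 1) = A $$ (0, 1)"
    and B0: "\<And>j. 2 \<le> j \<Longrightarrow> j < n \<Longrightarrow> B $$ (0, j) = max (A $$ (0, j)) (A $$ (1, j))"
    and B1: "\<And>j. 2 \<le> j \<Longrightarrow> j < n \<Longrightarrow> B $$ (1, j) = min (A $$ (0, j)) (A $$ (1, j))"
    and rest: "\<And>i j. 2 \<le> i \<Longrightarrow> 2 \<le> j \<Longrightarrow> i < n \<Longrightarrow> j < n \<Longrightarrow> B $$ (i, j) = A $$ (i, j)"
  shows "mat_trace (A ^\<^sub>m k) \<le> mat_trace (B ^\<^sub>m k)"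
    and "\<lbrakk>2 \<le> p; p < n; A $$ (1, p) < A $$ (0, p); 2 \<le> q; q < n; A $$ (0, q) < A $$ (1, q)\<rbrakk>
      \<Longrightarrow> mat_trace (A ^\<^sub>m 4) < mat_trace (B ^\<^sub>m 4)"
proof -
  define M where "M = pair_mat n A"
  define N where "N = pair_mat n B"
  have c: "M \<in> carrier_mat n n" "N \<in> carrier_mat n n" by (auto simp: M_def N_def pair_mat_def)
  have A10: "A $$ (1, 0) = A $$ (0, 1)" "B $$ (1, 0) = A $$ (0, 1)" using symA[of 1 0] symB[of 1 0] n top by auto
  have sym0: "A $$ (i, 0) = A $$ (0, i)" "A $$ (i, 1) = A $$ (1, i)"
      "B $$ (i, 0) = B $$ (0, i)" "B $$ (i, 1) = B $$ (1, i)" if "2 \<le> i" "i < n" for i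
    using symA[of i 0] symA[of i 1] symB[of i 0] symB[of i 1] n that by auto
  \<comment> \<open>The top block of \<open>M\<close> is diagonal with entries
    \<open>A $$ (0, 0) + A $$ (0, 1)\<close> and \<open>A $$ (0, 0) - A $$ (0, 1)\<close>,
    nonnegative by \<open>top\<close>. Next to it, \<open>max\<close> plus \<open>min\<close> is the
    sum of two entries and \<open>max\<close> minus \<open>min\<close> the absolute value of their
    difference, so only signs in row and column 1 can change.\<close>
  have abs: "\<bar>M $$ (i, j)\<bar> = N $$ (i, j)" if ij: "i < n" "j < n" for i j
  proof -
    have M: "M $$ (i, j) = (if i = 0 then (r A 0 + r A 1) / 2 else if i = 1 then (r A 0 - r A 1) / 2 else r A i)"
      and N: "N $$ (i, j) = (if i = 0 then (r B 0 + r B 1) / 2 else if i = 1 then (r B 0 - r B 1) / 2 else r B i)"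
      if "r = (\<lambda>A i. if j = 0 then A $$ (i, 0) + A $$ (i, 1) else if j = 1 then A $$ (i, 0) - A $$ (i, 1) else A $$ (i, j))"
      for r :: "real mat \<Rightarrow> nat \<Rightarrow> real"
      using ij that by (simp_all add: M_def N_def pair_mat_def Let_def)
    note e = M[OF refl] N[OF refl]
    consider "i < 2" "j < 2" | "i < 2" "2 \<le> j" | "2 \<le> i" "j < 2" | "2 \<le> i" "2 \<le> j" by linarith
    then show ?thesis
    proof cases
      case 1
      then show ?thesis using top A10 nonneg[of 0 0] nonneg[of 0 1] n
        by (auto simp: e less_2_cases_iff)
    next
      case 2
      then show ?thesis using B0[of j] B1[of j] nonneg[of 0 j] nonneg[of 1 j] n ij
        by (auto simp: e less_2_cases_iff)
    next
      case 3
      then show ?thesis using B0[of i] B1[of i] nonneg[of 0 i] nonneg[of 1 i] n ij sym0[of i]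
        by (auto simp: e less_2_cases_iff)
    next
      case 4
      then show ?thesis using rest[of i j] nonneg[of i j] ij by (auto simp: e)
    qed
  qed
  have trA: "mat_trace (A ^\<^sub>m k) = mat_trace (M ^\<^sub>m k)" for k
    unfolding M_def by (rule mat_trace_similar_pow[OF similar_pair_mat[OF A n]])
  have trB: "mat_trace (B ^\<^sub>m k) = mat_trace (N ^\<^sub>m k)" for k
    unfolding N_def by (rule mat_trace_similar_pow[OF similar_pair_mat[OF B n]])
  have pw: "\<bar>(M ^\<^sub>m k) $$ (i, j)\<bar> \<le> (N ^\<^sub>m k) $$ (i, j)" if "i < n" "j < n" for i j k
    by (rule abs_pow_mat_le[OF c]) (use abs that in auto)
  show "mat_trace (A ^\<^sub>m k) \<le> mat_trace (B ^\<^sub>m k)"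
    unfolding trA trB unfolding mat_trace_def using c abs_le_D1[OF pw] by (auto intro!: sum_mono)
  assume p: "2 \<le> p" "p < n" "A $$ (1, p) < A $$ (0, p)" and q: "2 \<le> q" "q < n" "A $$ (0, q) < A $$ (1, q)"
  \<comment> \<open>A term of each sign makes the triangle inequality strict, for the sum and for
    its negative.\<close>
  have strict: "\<bar>\<Sum>i<n. f i\<bar> < (\<Sum>i<n. \<bar>f i\<bar>)" if "f p > 0" "f q < 0" for f :: "nat \<Rightarrow> real"
  proof -
    have "(\<Sum>i<n. f i) < (\<Sum>i<n. \<bar>f i\<bar>)"
      by (rule sum_strict_mono_ex1) (use that q in \<open>auto intro!: bexI[of _ q]\<close>)
    moreover have "(\<Sum>i<n. - f i) < (\<Sum>i<n. \<bar>f i\<bar>)"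
      by (rule sum_strict_mono_ex1) (use that p in \<open>auto intro!: bexI[of _ p]\<close>)
    ultimately show ?thesis by (simp add: sum_negf)
  qed
  define M2 where "M2 = M * M"
  define N2 where "N2 = N * N"
  have c2: "M2 \<in> carrier_mat n n" "N2 \<in> carrier_mat n n" using c by (auto simp: M2_def N2_def)
  have M4: "M ^\<^sub>m 4 = M2 * M2" "N ^\<^sub>m 4 = N2 * N2"
    using c by (simp_all add: M2_def N2_def numeral_eq_Suc assoc_mult_mat[of _ n n _ n _ n])
  have le2: "\<bar>M2 $$ (i, j)\<bar> \<le> N2 $$ (i, j)" if "i < n" "j < n" for i j
    unfolding M2_def N2_def by (rule abs_mult_mat_le[OF c(1) c(1) c(2) c(2)]) (use abs that in auto)
  have N2: "N2 $$ (i, j) = (\<Sum>k<n. \<bar>M $$ (i, k) * M $$ (k, j)\<bar>)" if "i < n" "j < n" for i j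
    using that by (auto simp: N2_def index_mult_mat_sum[OF c(2) c(2)] abs_mult abs simp del: index_mult_mat(1))
  have M2: "M2 $$ (i, j) = (\<Sum>k<n. M $$ (i, k) * M $$ (k, j))" if "i < n" "j < n" for i j
    using that by (auto simp: M2_def index_mult_mat_sum[OF c(1) c(1)] simp del: index_mult_mat(1))
  have pos: "0 < A $$ (0, p)" "0 < A $$ (1, q)" "0 \<le> A $$ (1, p)" "0 \<le> A $$ (0, q)"
    using p q nonneg[of 1 p] nonneg[of 0 q] n by auto
  \<comment> \<open>The entries (1, 0) and (0, 1) of the square pair symmetric with antisymmetric
    coordinates: the term at \<open>p\<close> is positive and the term at \<open>q\<close> negative,
    so there is cancellation for \<open>M\<close> and none for \<open>N\<close>.\<close>
  have s10: "\<bar>M2 $$ (1, 0)\<bar> < N2 $$ (1, 0)"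
  proof -
    have "M $$ (1, p) > 0" "M $$ (1, q) < 0" "M $$ (p, 0) > 0" "M $$ (q, 0) > 0"
      using n p q pos sym0[of p] sym0[of q] by (auto simp: M_def pair_mat_def)
    then show ?thesis using n strict[of "\<lambda>k. M $$ (1, k) * M $$ (k, 0)"] by (simp add: M2 N2 mult_neg_pos)
  qed
  have s01: "\<bar>M2 $$ (0, 1)\<bar> < N2 $$ (0, 1)"
  proof -
    have "M $$ (p, 1) > 0" "M $$ (q, 1) < 0" "M $$ (0, p) > 0" "M $$ (0, q) > 0"
      using n p q pos sym0[of p] sym0[of q] by (auto simp: M_def pair_mat_def)
    then show ?thesis using n strict[of "\<lambda>k. M $$ (0, k) * M $$ (k, 1)"] by (simp add: M2 N2 mult_pos_neg)
  qed
  \<comment> \<open>The strict gain lies off the diagonal of the square and so reaches the trace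
    through the fourth power: in the diagonal entry (1, 1) of \<open>M2 * M2\<close>, the term
    \<open>k = 0\<close> multiplies the entries (1, 0) and (0, 1) of \<open>M2\<close>.\<close>
  have "(\<Sum>k<n. M2 $$ (1, k) * M2 $$ (k, 1)) < (\<Sum>k<n. N2 $$ (1, k) * N2 $$ (k, 1))"
  proof (rule sum_strict_mono_ex1)
    show "\<forall>k\<in>{..<n}. M2 $$ (1, k) * M2 $$ (k, 1) \<le> N2 $$ (1, k) * N2 $$ (k, 1)"
    proof
      fix k assume "k \<in> {..<n}"
      then have "\<bar>M2 $$ (1, k)\<bar> * \<bar>M2 $$ (k, 1)\<bar> \<le> N2 $$ (1, k) * N2 $$ (k, 1)"
        using le2[of 1 k] le2[of k 1] n by (intro mult_mono) auto
      then show "M2 $$ (1, k) * M2 $$ (k, 1) \<le> N2 $$ (1, k) * N2 $$ (k, 1)"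
        by (metis abs_ge_self abs_mult order_trans)
    qed
    have "\<bar>M2 $$ (1, 0)\<bar> * \<bar>M2 $$ (0, 1)\<bar> < N2 $$ (1, 0) * N2 $$ (0, 1)"
      using s10 s01 by (intro mult_strict_mono) auto
    then have "M2 $$ (1, 0) * M2 $$ (0, 1) < N2 $$ (1, 0) * N2 $$ (0, 1)"
      by (metis abs_ge_self abs_mult order_le_less_trans)
    then show "\<exists>k\<in>{..<n}. M2 $$ (1, k) * M2 $$ (k, 1) < N2 $$ (1, k) * N2 $$ (k, 1)"
      using n by (intro bexI[of _ 0]) auto
  qed simp
  then have "(M ^\<^sub>m 4) $$ (1, 1) < (N ^\<^sub>m 4) $$ (1, 1)"
    using n by (simp add: M4 index_mult_mat_sum[OF c2(1) c2(1)] index_mult_mat_sum[OF c2(2) c2(2)] del: index_mult_mat(1))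
  moreover have "(M ^\<^sub>m 4) $$ (i, i) \<le> (N ^\<^sub>m 4) $$ (i, i)" if "i < n" for i
    using pw[of i i 4] that by auto
  ultimately have "(\<Sum>i<n. (M ^\<^sub>m 4) $$ (i, i)) < (\<Sum>i<n. (N ^\<^sub>m 4) $$ (i, i))"
    using n by (intro sum_strict_mono_ex1) (auto intro!: bexI[of _ 1])
  then show "mat_trace (A ^\<^sub>m 4) < mat_trace (B ^\<^sub>m 4)"
    unfolding trA trB unfolding mat_trace_def using c by simp
qed

section \<open>Resolvent energy and the Kelmans transformation\<close>

lemma pair_graph_parcs:
  assumes "pair_graph G"
  shows pair_graph_sym: "(x, y) \<in> parcs G \<longleftrightarrow> (y, x) \<in> parcs G"
    and pair_graph_irrefl: "(x, x) \<notin> parcs G"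
    and pair_graph_in_verts: "(x, y) \<in> parcs G \<Longrightarrow> x \<in> pverts G \<and> y \<in> pverts G"
proof -
  interpret pair_graph G by fact
  show "(x, y) \<in> parcs G \<longleftrightarrow> (y, x) \<in> parcs G"
    using pair_sym_arcs by (auto simp: symmetric_def sym_def)
  show "(x, x) \<notin> parcs G" using no_loops' by blast
  show "(x, y) \<in> parcs G \<Longrightarrow> x \<in> pverts G \<and> y \<in> pverts G"
    using in_arcsD1 in_arcsD2 by blast
qed

text \<open>Each eigenvalue \<open>x\<close> contributes a geometric series with ratio
  \<open>(x + 1) / (n + 1)\<close> and sum \<open>1 / (n - x)\<close>. The shift by 1 puts ones on
  the diagonal of the matrix, which later secures \<open>A $$ (0, 1) \<le> A $$ (0, 0)\<close> even
  for adjacent vertices.\<close>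

lemma resolvent_energy_sums:
  assumes G: "pair_graph G" and vs: "distinct vs" "set vs = pverts G"
  shows "(\<lambda>k. mat_trace ((adjacency_matrix G vs + 1\<^sub>m (length vs)) ^\<^sub>m k) / (real (length vs) + 1) ^ Suc k)
    sums resolvent_energy G"
proof -
  let ?n = "length vs" and ?A = "adjacency_matrix G vs"
  obtain es where es: "mset es = adj_spectrum G" by (metis ex_mset)
  have A: "?A \<in> carrier_mat ?n ?n" by simp
  have sp: "adj_spectrum G = proots (char_poly ?A)" by (rule adj_spectrum_eq[OF vs])
  have dm: "degree (char_poly ?A) = ?n" "coeff (char_poly ?A) ?n = 1"
    using degree_monic_char_poly[OF A] by auto
  have card: "card (pverts G) = ?n" using distinct_card[OF vs(1)] vs(2) by simp
  have "size (proots (char_poly ?A)) = degree (char_poly ?A)"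
    using size_adj_spectrum[OF G] card dm by (simp add: sp)
  then have cp: "char_poly ?A = (\<Prod>e\<leftarrow>es. [:- e, 1:])"
    by (rule monic_split_proots) (use dm es sp in auto)
  have tr: "mat_trace ((?A + 1\<^sub>m ?n) ^\<^sub>m k) = (\<Sum>i<length es. (es ! i + 1) ^ k)" for k
    unfolding mat_trace_shift_pow[OF A cp] by (simp add: sum_list_sum_nth lessThan_atLeast0)
  \<comment> \<open>A crude bound suffices because the ratio has denominator \<open>n + 1\<close>: a
    single square \<open>(x + 1)^2\<close> is at most the trace of the squared matrix, a sum of
    \<open>n^2\<close> terms that are each at most 1.\<close>
  have bound: "\<bar>es ! i + 1\<bar> \<le> real ?n" if i: "i < length es" for i
  proof -
    let ?B = "?A + 1\<^sub>m ?n"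
    have B: "?B \<in> carrier_mat ?n ?n" by simp
    have ent: "\<bar>?B $$ (j, k)\<bar> \<le> 1" if "j < ?n" "k < ?n" for j k
      using that pair_graph_irrefl[OF G] by (auto simp: adjacency_matrix_def)
    have "(es ! i + 1)\<^sup>2 \<le> (\<Sum>i<length es. (es ! i + 1)\<^sup>2)"
      by (rule member_le_sum) (use i in auto)
    also have "\<dots> = mat_trace (?B ^\<^sub>m 2)" by (simp add: tr)
    also have "?B ^\<^sub>m 2 = ?B * ?B" using B by (simp add: numeral_2_eq_2)
    also have "mat_trace (?B * ?B) = (\<Sum>j<?n. \<Sum>k<?n. ?B $$ (j, k) * ?B $$ (k, j))"
      using B by (simp add: mat_trace_def index_mult_mat_sum[OF B B] del: index_mult_mat(1) index_add_mat(1))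
    also have "\<dots> \<le> (\<Sum>j<?n. \<Sum>k<?n. 1)"
    proof (intro sum_mono)
      fix j k assume "j \<in> {..<?n}" "k \<in> {..<?n}"
      then have "\<bar>?B $$ (j, k)\<bar> * \<bar>?B $$ (k, j)\<bar> \<le> 1 * 1" using ent by (intro mult_mono) auto
      then show "?B $$ (j, k) * ?B $$ (k, j) \<le> 1" by (metis abs_le_D1 abs_mult mult_1)
    qed
    also have "\<dots> = (real ?n)\<^sup>2" by (simp add: power2_eq_square)
    finally show ?thesis by (metis abs_le_square_iff abs_of_nat)
  qed
  have "(\<lambda>k. (es ! i + 1) ^ k / (real ?n + 1) ^ Suc k) sums (1 / (real ?n - es ! i))" if "i < length es" for i
  proof -
    let ?x = "(es ! i + 1) / (real ?n + 1)"
    have "norm ?x < 1" using bound[OF that] by (simp add: abs_divide)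
    then have "(\<lambda>k. ?x ^ k / (real ?n + 1)) sums (1 / (1 - ?x) / (real ?n + 1))"
      by (intro sums_divide geometric_sums)
    moreover have "1 / (1 - ?x) / (real ?n + 1) = 1 / (real ?n - es ! i)"
    proof -
      have "1 - ?x = (real ?n - es ! i) / (real ?n + 1)"
        by (simp add: field_simps)
      then show ?thesis by simp
    qed
    moreover have "?x ^ k / (real ?n + 1) = (es ! i + 1) ^ k / (real ?n + 1) ^ Suc k" for k
      by (simp add: power_divide mult.commute)
    ultimately show ?thesis by simp
  qed
  then have "(\<lambda>k. \<Sum>i<length es. (es ! i + 1) ^ k / (real ?n + 1) ^ Suc k)
      sums (\<Sum>i<length es. 1 / (real ?n - es ! i))"
    by (intro sums_sum) auto
  moreover have "resolvent_energy G = (\<Sum>i<length es. 1 / (real ?n - es ! i))"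
    unfolding resolvent_energy_def card es[symmetric]
    by (simp add: sum_mset_sum_list sum_list_sum_nth lessThan_atLeast0 flip: mset_map)
  ultimately show ?thesis by (simp add: tr sum_divide_distrib)
qed

section \<open>The Kelmans transformation\<close>

definition private_nbrs :: "'a pair_pre_digraph \<Rightarrow> 'a \<Rightarrow> 'a \<Rightarrow> 'a set" where
  "private_nbrs G u v = {x. (u, x) \<in> parcs G \<and> (v, x) \<notin> parcs G \<and> x \<noteq> v}"

text \<open>Arcs are exchanged in both directions to keep the relation symmetric. Since
  \<open>private_nbrs G v u\<close> excludes \<open>u\<close>, an edge between \<open>u\<close> and
  \<open>v\<close> stays in place instead of producing a loop at \<open>u\<close>.\<close>

definition kelmans :: "'a pair_pre_digraph \<Rightarrow> 'a \<Rightarrow> 'a \<Rightarrow> 'a pair_pre_digraph" where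
  "kelmans G u v = (let W = private_nbrs G v u in
     \<lparr> pverts = pverts G,
       parcs = (parcs G - ({v} \<times> W \<union> W \<times> {v})) \<union> ({u} \<times> W \<union> W \<times> {u}) \<rparr>)"

lemma pverts_kelmans [simp]: "pverts (kelmans G u v) = pverts G"
  by (simp add: kelmans_def Let_def)

lemma parcs_kelmans:
  "parcs (kelmans G u v) = (parcs G - ({v} \<times> private_nbrs G v u \<union> private_nbrs G v u \<times> {v}))
     \<union> ({u} \<times> private_nbrs G v u \<union> private_nbrs G v u \<times> {u})"
  by (simp add: kelmans_def Let_def)

lemma private_nbrs_simps:
  assumes "pair_graph G"
  shows "u \<notin> private_nbrs G u v" "v \<notin> private_nbrs G u v" "private_nbrs G u v \<subseteq> pverts G"
  using pair_graph_irrefl[OF assms] pair_graph_in_verts[OF assms] by (auto simp: private_nbrs_def)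

lemma pair_graph_kelmans:
  assumes G: "pair_graph G" and u: "u \<in> pverts G"
  shows "pair_graph (kelmans G u v)"
proof -
  interpret pair_graph G by fact
  note W = private_nbrs_simps[OF G, where u = v and v = u]
  have sub: "parcs (kelmans G u v) \<subseteq> pverts G \<times> pverts G"
    using W u pair_graph_in_verts[OF G] unfolding parcs_kelmans by auto
  show ?thesis
  proof
    fix e assume e: "e \<in> parcs (kelmans G u v)"
    then show "fst e \<in> pverts (kelmans G u v)" "snd e \<in> pverts (kelmans G u v)"
      using sub by (auto simp: mem_Times_iff)
    show "fst e \<noteq> snd e"
      using e W pair_graph_irrefl[OF G] unfolding parcs_kelmans by (cases e) auto
  next
    show "finite (pverts (kelmans G u v))" by simp
    show "finite (parcs (kelmans G u v))"
      using sub by (rule finite_subset) auto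
    have "sym (parcs (kelmans G u v))"
      using pair_graph_sym[OF G] by (auto simp: sym_def parcs_kelmans)
    then show "symmetric (with_proj (kelmans G u v))"
      by (simp add: symmetric_def)
  qed
qed

text \<open>With \<open>u\<close> and \<open>v\<close> listed first, the shifted adjacency matrices
  meet the hypotheses of \<open>trace_pow_le_compress\<close>. The two series for the resolvent
  energies are then compared term by term, with a strict gain at exponent 4.\<close>

lemma resolvent_energy_kelmans_less:
  assumes G: "pair_graph G" and uv: "u \<in> pverts G" "v \<in> pverts G" "u \<noteq> v"
    and ne: "private_nbrs G u v \<noteq> {}" "private_nbrs G v u \<noteq> {}"
  shows "resolvent_energy G < resolvent_energy (kelmans G u v)"
proof -
  interpret pair_graph G by fact
  let ?K = "kelmans G u v"
  note K = pair_graph_kelmans[OF G uv(1), of v]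
  obtain ws where ws: "distinct ws" "set ws = pverts G - {u, v}"
    using finite_distinct_list[of "pverts G - {u, v}"] by auto
  define vs where "vs = u # v # ws"
  have vs: "distinct vs" "set vs = pverts G" using ws uv by (auto simp: vs_def)
  define n where "n = length vs"
  have n: "2 \<le> n" by (simp add: n_def vs_def)
  have vs01: "vs ! 0 = u" "vs ! 1 = v" by (simp_all add: vs_def)
  have vsj: "vs ! j \<noteq> u" "vs ! j \<noteq> v" if "2 \<le> j" "j < n" for j
  proof -
    have "vs ! j \<in> set ws" using that by (auto simp: vs_def n_def numeral_2_eq_2 nth_Cons')
    then show "vs ! j \<noteq> u" "vs ! j \<noteq> v" using ws by auto
  qed
  define A where "A = adjacency_matrix G vs + 1\<^sub>m n"
  define B where "B = adjacency_matrix ?K vs + 1\<^sub>m n"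
  have A: "A \<in> carrier_mat n n" and B: "B \<in> carrier_mat n n" by (auto simp: A_def B_def n_def)
  have Aij: "A $$ (i, j) = (if (vs ! i, vs ! j) \<in> parcs G then 1 else 0) + (if i = j then 1 else 0)"
    and Bij: "B $$ (i, j) = (if (vs ! i, vs ! j) \<in> parcs ?K then 1 else 0) + (if i = j then 1 else 0)"
    if "i < n" "j < n" for i j using that by (simp_all add: A_def B_def n_def adjacency_matrix_def)
  note irr = pair_graph_irrefl[OF G] pair_graph_irrefl[OF K]
  \<comment> \<open>Away from \<open>u\<close> and \<open>v\<close>, the new neighbourhood of
    \<open>u\<close> is the union of the old ones and that of \<open>v\<close> their intersection;
    on 0/1 entries these become \<open>max\<close> and \<open>min\<close>.\<close>
  have Ku: "(u, x) \<in> parcs ?K \<longleftrightarrow> (u, x) \<in> parcs G \<or> (v, x) \<in> parcs G"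
    and Kv: "(v, x) \<in> parcs ?K \<longleftrightarrow> (u, x) \<in> parcs G \<and> (v, x) \<in> parcs G" if "x \<noteq> u" "x \<noteq> v" for x
    using that uv irr by (auto simp: parcs_kelmans private_nbrs_def)
  have Kuv: "(u, v) \<in> parcs ?K \<longleftrightarrow> (u, v) \<in> parcs G"
    using uv irr by (auto simp: parcs_kelmans private_nbrs_def)
  have Kxy: "(x, y) \<in> parcs ?K \<longleftrightarrow> (x, y) \<in> parcs G" if "x \<notin> {u, v}" "y \<notin> {u, v}" for x y
    using that by (auto simp: parcs_kelmans)
  have symA: "A $$ (i, j) = A $$ (j, i)" and symB: "B $$ (i, j) = B $$ (j, i)" if "i < n" "j < n" for i j
    using that pair_graph_sym[OF G] pair_graph_sym[OF K] by (auto simp: Aij Bij)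
  have nonneg: "0 \<le> A $$ (i, j)" if "i < n" "j < n" for i j using that by (auto simp: Aij)
  have top: "A $$ (0, 0) = A $$ (1, 1)" "A $$ (0, 1) \<le> A $$ (0, 0)"
      "B $$ (0, 0) = A $$ (0, 0)" "B $$ (1, 1) = A $$ (1, 1)" "B $$ (0, 1) = A $$ (0, 1)"
    using n Kuv irr by (simp_all add: Aij Bij vs01[unfolded One_nat_def])
  have B0: "B $$ (0, j) = max (A $$ (0, j)) (A $$ (1, j))"
    and B1: "B $$ (1, j) = min (A $$ (0, j)) (A $$ (1, j))" if j: "2 \<le> j" "j < n" for j
    using n j Ku[OF vsj[OF j]] Kv[OF vsj[OF j]] by (auto simp: Aij Bij vs01[unfolded One_nat_def])
  have rest: "B $$ (i, j) = A $$ (i, j)" if "2 \<le> i" "2 \<le> j" "i < n" "j < n" for i j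
    using that vsj[of i] vsj[of j] by (simp add: Aij Bij Kxy)
  have idx: "\<exists>j. 2 \<le> j \<and> j < n \<and> vs ! j = x" if x: "x \<in> pverts G" "x \<noteq> u" "x \<noteq> v" for x
  proof -
    obtain j where j: "j < n" "vs ! j = x" using x vs by (metis in_set_conv_nth n_def)
    then have "j \<noteq> 0" "j \<noteq> 1" using x vs01 by metis+
    then show ?thesis using j by (intro exI[of _ j]) auto
  qed
  obtain x where x: "x \<in> private_nbrs G u v" using ne by auto
  obtain y where y: "y \<in> private_nbrs G v u" using ne by auto
  obtain p where p: "2 \<le> p" "p < n" "vs ! p = x"
    using idx[of x] x private_nbrs_simps[OF G, where u = u and v = v] by auto
  obtain q where q: "2 \<le> q" "q < n" "vs ! q = y"
    using idx[of y] y private_nbrs_simps[OF G, where u = v and v = u] by auto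
  \<comment> \<open>Private neighbours on both sides supply the two columns in which rows 0 and 1
    differ in opposite directions, as strictness requires.\<close>
  have p': "A $$ (1, p) < A $$ (0, p)" and q': "A $$ (0, q) < A $$ (1, q)"
    using x y p q n by (auto simp: Aij vs01[unfolded One_nat_def] private_nbrs_def)
  have le: "mat_trace (A ^\<^sub>m k) \<le> mat_trace (B ^\<^sub>m k)" for k
    by (rule trace_pow_le_compress(1)[OF A B n _ _ _ top]) (fact symA symB nonneg B0 B1 rest)+
  have less: "mat_trace (A ^\<^sub>m 4) < mat_trace (B ^\<^sub>m 4)"
    by (rule trace_pow_le_compress(2)[OF A B n _ _ _ top, where p = p and q = q])
      (fact symA symB nonneg B0 B1 rest p q p' q')+
  let ?d = "\<lambda>k. mat_trace (B ^\<^sub>m k) / (real n + 1) ^ Suc k - mat_trace (A ^\<^sub>m k) / (real n + 1) ^ Suc k"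
  have d: "?d sums (resolvent_energy ?K - resolvent_energy G)"
    using resolvent_energy_sums[OF G vs] resolvent_energy_sums[OF K vs(1)] vs(2)
    by (intro sums_diff) (auto simp: A_def B_def n_def)
  have "0 < suminf ?d"
  proof (rule suminf_pos2)
    show "summable ?d" using d by (rule sums_summable)
    show "0 \<le> ?d k" for k using le[of k] by (simp add: divide_right_mono)
    show "0 < ?d 4" using less by (simp add: divide_strict_right_mono)
  qed
  then show ?thesis using d by (simp add: sums_iff)
qed

section \<open>Bicyclic graphs of maximal resolvent energy\<close>

text \<open>\<open>connected\<close> symmetrises the graph and restricts walks to its vertices. For
  a symmetric arc relation whose ends are vertices neither changes reachability between
  vertices.\<close>

lemma connected_pair_graph_iff:
  assumes "pair_graph G"
  shows "Digraph_Component.connected (with_proj G) \<longleftrightarrow>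
    pverts G \<noteq> {} \<and> (\<forall>x\<in>pverts G. \<forall>y\<in>pverts G. (x, y) \<in> (parcs G)\<^sup>*)"
proof -
  interpret pair_graph G by fact
  have ends: "arcs_ends (with_proj G) = parcs G" by (simp add: arcs_ends_def arc_to_ends_def)
  have "(x \<rightarrow>\<^sup>*\<^bsub>with_proj G\<^esub> y) \<longleftrightarrow> (x, y) \<in> (parcs G)\<^sup>*" if "x \<in> pverts G" "y \<in> pverts G" for x y
    unfolding reachable_def ends using that pair_graph_in_verts[OF assms]
    by (auto intro: rtrancl_on_rtranclI rtrancl_consistent_rtrancl_on)
  then show ?thesis
    unfolding connected_def strongly_connected_def
    by (simp add: reachable_mk_symmetric_eq[OF sym_arcs])
qed

lemma doubleton_in_uedges_iff:
  assumes "pair_graph G"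
  shows "{x, y} \<in> uedges G \<longleftrightarrow> (x, y) \<in> parcs G"
  using pair_graph_sym[OF assms] by (auto simp: uedges_def doubleton_eq_iff)

lemma uedgesE:
  assumes "e \<in> uedges G"
  obtains x y where "e = {x, y}" "(x, y) \<in> parcs G"
  using assms by (auto simp: uedges_def)

lemma finite_uedges: "pair_graph G \<Longrightarrow> finite (uedges G)"
  unfolding uedges_def by (intro finite_imageI) (rule pair_fin_digraph.pair_finite_arcs, simp add: pair_graph_def pair_digraph_def)

text \<open>Each moved edge \<open>{v, x}\<close> is replaced by \<open>{u, x}\<close>, which was
  absent because \<open>x\<close> is private to \<open>v\<close>; so as many edges are gained as
  lost.\<close>

lemma card_uedges_kelmans:
  assumes G: "pair_graph G" and uv: "u \<in> pverts G" "u \<noteq> v"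
  shows "card (uedges (kelmans G u v)) = card (uedges G)"
proof -
  let ?W = "private_nbrs G v u"
  let ?D = "(\<lambda>x. {v, x}) ` ?W" and ?C = "(\<lambda>x. {u, x}) ` ?W"
  note W = private_nbrs_simps[OF G, where u = v and v = u]
  note K = pair_graph_kelmans[OF G uv(1), of v]
  have eq: "uedges (kelmans G u v) = (uedges G - ?D) \<union> ?C"
  proof (intro Set.set_eqI iffI)
    fix e assume "e \<in> uedges (kelmans G u v)"
    then obtain x y where e: "e = {x, y}" and "(x, y) \<in> parcs (kelmans G u v)" by (rule uedgesE)
    then consider "(x, y) \<in> parcs G" "(x, y) \<notin> {v} \<times> ?W \<union> ?W \<times> {v}" | "x = u" "y \<in> ?W" | "x \<in> ?W" "y = u"
      unfolding parcs_kelmans by blast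
    then show "e \<in> (uedges G - ?D) \<union> ?C"
    proof cases
      case 1
      have "{x, y} \<noteq> {v, z}" if "z \<in> ?W" for z using 1(2) that by (auto simp: doubleton_eq_iff)
      then show ?thesis using 1(1) e doubleton_in_uedges_iff[OF G] by auto
    next
      case 2
      then show ?thesis using e by auto
    next
      case 3
      then have "e = {u, x}" using e by auto
      then show ?thesis using 3 by auto
    qed
  next
    fix e assume "e \<in> (uedges G - ?D) \<union> ?C"
    then show "e \<in> uedges (kelmans G u v)"
    proof
      assume e: "e \<in> uedges G - ?D"
      then obtain x y where xy: "e = {x, y}" "(x, y) \<in> parcs G" by (auto elim: uedgesE)
      moreover have "{x, v} = {v, x}" by auto
      ultimately have "(x, y) \<notin> {v} \<times> ?W \<union> ?W \<times> {v}" using e by auto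
      then have "(x, y) \<in> parcs (kelmans G u v)" using xy by (auto simp: parcs_kelmans)
      then show ?thesis using xy doubleton_in_uedges_iff[OF K] by simp
    next
      assume "e \<in> ?C"
      then show ?thesis by (auto simp: doubleton_in_uedges_iff[OF K] parcs_kelmans)
    qed
  qed
  have fin: "finite ?W" by (rule finite_subset[OF W(3)]) (use G in \<open>simp add: pair_graph_def pair_digraph_def pair_fin_digraph.pair_finite_verts\<close>)
  have sub: "?D \<subseteq> uedges G" by (auto simp: doubleton_in_uedges_iff[OF G] private_nbrs_def)
  have disj: "(uedges G - ?D) \<inter> ?C = {}"
    by (auto simp: doubleton_in_uedges_iff[OF G] private_nbrs_def)
  have "card ?D = card ?W" "card ?C = card ?W"
    by (auto intro!: card_image simp: inj_on_def doubleton_eq_iff)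
  moreover have "card ((uedges G - ?D) \<union> ?C) = card (uedges G - ?D) + card ?C"
    by (rule card_Un_disjoint) (use finite_uedges[OF G] fin disj in auto)
  moreover have "card (uedges G - ?D) = card (uedges G) - card ?D"
    by (rule card_Diff_subset) (use fin sub in auto)
  moreover have "card ?D \<le> card (uedges G)" by (rule card_mono[OF finite_uedges[OF G] sub])
  ultimately show ?thesis by (simp add: eq)
qed

text \<open>The only arcs lost join \<open>v\<close> to \<open>private_nbrs G v u\<close>, and those
  vertices are now neighbours of \<open>u\<close>. So connectedness only needs a walk from
  \<open>u\<close> to \<open>v\<close>; the edge between them, or the path through a common
  neighbour, survives the transformation.\<close>

lemma bicyclic_kelmans:
  assumes G: "bicyclic G" and uv: "u \<in> pverts G" "v \<in> pverts G" "u \<noteq> v"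
    and near: "(u, v) \<in> parcs G \<or> (\<exists>c. (u, c) \<in> parcs G \<and> (v, c) \<in> parcs G)"
  shows "bicyclic (kelmans G u v)"
proof -
  let ?K = "kelmans G u v" and ?W = "private_nbrs G v u"
  have pg: "pair_graph G" using G by (simp add: bicyclic_def)
  note K = pair_graph_kelmans[OF pg uv(1), of v]
  note irr = pair_graph_irrefl[OF pg]
  have symK: "(y, x) \<in> (parcs ?K)\<^sup>*" if "(x, y) \<in> (parcs ?K)\<^sup>*" for x y
    using that pair_graph_sym[OF K] by (metis sym_def sym_rtrancl)
  have uvK: "(u, v) \<in> (parcs ?K)\<^sup>*"
    using near
  proof
    assume "(u, v) \<in> parcs G"
    then have "(u, v) \<in> parcs ?K" using uv irr by (auto simp: parcs_kelmans private_nbrs_def)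
    then show ?thesis by blast
  next
    assume "\<exists>c. (u, c) \<in> parcs G \<and> (v, c) \<in> parcs G"
    then obtain c where "(u, c) \<in> parcs G" "(v, c) \<in> parcs G" by blast
    then have "(u, c) \<in> parcs ?K" "(v, c) \<in> parcs ?K"
      using uv irr by (auto simp: parcs_kelmans private_nbrs_def)
    then show ?thesis using pair_graph_sym[OF K] by (meson r_into_rtrancl rtrancl_into_rtrancl)
  qed
  have vx: "(v, x) \<in> (parcs ?K)\<^sup>*" if "x \<in> ?W" for x
    using symK[OF uvK] that by (auto simp: parcs_kelmans intro: rtrancl_into_rtrancl)
  have "(x, y) \<in> (parcs ?K)\<^sup>*" if xy: "(x, y) \<in> parcs G" for x y
  proof (cases "(x, y) \<in> {v} \<times> ?W \<union> ?W \<times> {v}")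
    case True
    then show ?thesis using vx symK[OF vx] by auto
  next
    case False
    then show ?thesis using xy by (auto simp: parcs_kelmans)
  qed
  then have "(parcs G)\<^sup>* \<subseteq> (parcs ?K)\<^sup>*" by (metis rtrancl_subset_rtrancl subrelI)
  then show ?thesis
    using G card_uedges_kelmans[OF pg uv(1,3)] K
    unfolding bicyclic_def connected_pair_graph_iff[OF pg] connected_pair_graph_iff[OF K] by auto
qed

section \<open>Invariance under isomorphism\<close>

lemma digraph_iso_pairI:
  assumes G: "pair_graph G" and inj: "inj_on f (pverts G)"
    and V: "pverts H = f ` pverts G" and E: "parcs H = map_prod f f ` parcs G"
  shows "digraph_iso (with_proj G) (with_proj H)"
proof -
  interpret pair_graph G by fact
  let ?h = "\<lparr> iso_verts = f, iso_arcs = map_prod f f, iso_head = snd, iso_tail = fst \<rparr>"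
  have "inj_on (map_prod f f) (parcs G)"
    using inj pair_graph_in_verts[OF G] by (fastforce simp: inj_on_def)
  then have "pre_digraph.digraph_isomorphism (with_proj G) ?h"
    using inj wf_digraph by (auto simp: pre_digraph.digraph_isomorphism_def)
  moreover have "with_proj H = app_iso ?h (with_proj G)"
    by (simp add: app_iso_def with_proj_def V E)
  ultimately show ?thesis unfolding digraph_iso_def by blast
qed

text \<open>An isomorphism carries an enumeration of the vertices of \<open>G\<close> to one for
  \<open>H\<close> with the very same adjacency matrix.\<close>

lemma resolvent_energy_iso:
  assumes G: "pair_graph G" and iso: "digraph_iso (with_proj G) (with_proj H)"
  shows "resolvent_energy G = resolvent_energy H"
proof -
  interpret pair_graph G by fact
  obtain h where h: "pre_digraph.digraph_isomorphism (with_proj G) h"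
    and H: "with_proj H = app_iso h (with_proj G)"
    using iso unfolding digraph_iso_def by blast
  define f where "f = iso_verts h"
  have V: "pverts H = f ` pverts G" using arg_cong[OF H, of verts] by (simp add: f_def)
  have E: "parcs H = iso_arcs h ` parcs G" using arg_cong[OF H, of arcs] by simp
  \<comment> \<open>The tail and head maps of \<open>H\<close> are the projections. Comparing record
    fields thus determines those of the isomorphism, and the arc map must apply \<open>f\<close> to
    both ends.\<close>
  have ht: "iso_tail h = fst" "iso_head h = snd"
    using arg_cong[OF H, of tail] arg_cong[OF H, of head] by simp_all
  have inj: "inj_on f (pverts G)" using h by (simp add: pre_digraph.digraph_isomorphism_def f_def)
  have arc: "iso_arcs h (x, y) = (f x, f y)" if "(x, y) \<in> parcs G" for x y
    using h that ht by (auto simp: pre_digraph.digraph_isomorphism_def f_def prod_eq_iff)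
  have adj: "(f x, f y) \<in> parcs H \<longleftrightarrow> (x, y) \<in> parcs G" if xy: "x \<in> pverts G" "y \<in> pverts G" for x y
  proof
    assume "(x, y) \<in> parcs G"
    then show "(f x, f y) \<in> parcs H" unfolding E using arc by force
  next
    assume "(f x, f y) \<in> parcs H"
    then obtain a b where ab: "(a, b) \<in> parcs G" "(f x, f y) = iso_arcs h (a, b)" unfolding E by auto
    then have "f x = f a" "f y = f b" using arc by auto
    then have "x = a" "y = b" using inj xy pair_graph_in_verts[OF G ab(1)] by (auto dest: inj_onD)
    then show "(x, y) \<in> parcs G" using ab by simp
  qed
  obtain vs where vs: "distinct vs" "set vs = pverts G"
    using finite_distinct_list[OF pair_finite_verts] by blast
  have ws: "distinct (map f vs)" "set (map f vs) = pverts H"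
    using vs inj V by (simp_all add: distinct_map)
  have "adjacency_matrix H (map f vs) = adjacency_matrix G vs"
    unfolding adjacency_matrix_def using adj vs(2) nth_mem[of _ vs] by (intro eq_matI) auto
  then have "adj_spectrum H = adj_spectrum G"
    using adj_spectrum_eq[OF vs] adj_spectrum_eq[OF ws] by simp
  moreover have "card (pverts H) = card (pverts G)" unfolding V by (rule card_image[OF inj])
  ultimately show ?thesis by (simp add: resolvent_energy_def)
qed

section \<open>Structure of locally nested bicyclic graphs\<close>

definition locally_nested :: "'a pair_pre_digraph \<Rightarrow> bool" where
  "locally_nested G \<longleftrightarrow> (\<forall>u\<in>pverts G. \<forall>v\<in>pverts G. u \<noteq> v \<longrightarrow>
     (u, v) \<in> parcs G \<or> (\<exists>c. (u, c) \<in> parcs G \<and> (v, c) \<in> parcs G) \<longrightarrow>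
     private_nbrs G u v = {} \<or> private_nbrs G v u = {})"

text \<open>Let \<open>w\<close> have maximal degree. If it misses a vertex, some neighbour
  \<open>c\<close> of \<open>w\<close> has a neighbour \<open>y\<close> outside the closed
  neighbourhood of \<open>w\<close>. As \<open>y\<close> is private to \<open>c\<close>, nestedness
  makes \<open>c\<close> adjacent to all other neighbours of \<open>w\<close>; with \<open>w\<close>
  and \<open>y\<close> in addition, its degree exceeds that of \<open>w\<close>.\<close>

lemma locally_nested_dominating:
  assumes G: "pair_graph G" and conn: "Digraph_Component.connected (with_proj G)"
    and nested: "locally_nested G"
  obtains w where "w \<in> pverts G" "\<And>x. x \<in> pverts G \<Longrightarrow> x \<noteq> w \<Longrightarrow> (w, x) \<in> parcs G"
proof -
  interpret pair_graph G by fact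
  define nb where "nb x = {y. (x, y) \<in> parcs G}" for x
  have fin: "finite (nb x)" for x
    by (rule finite_subset[of _ "pverts G"]) (use pair_graph_in_verts[OF G] in \<open>auto simp: nb_def\<close>)
  have ne: "pverts G \<noteq> {}" and reach: "\<And>x y. x \<in> pverts G \<Longrightarrow> y \<in> pverts G \<Longrightarrow> (x, y) \<in> (parcs G)\<^sup>*"
    using conn connected_pair_graph_iff[OF G] by auto
  obtain w where w: "w \<in> pverts G" and max: "\<And>x. x \<in> pverts G \<Longrightarrow> card (nb x) \<le> card (nb w)"
  proof -
    let ?D = "(\<lambda>x. card (nb x)) ` pverts G"
    have "Max ?D \<in> ?D" using ne by (intro Max_in) auto
    moreover have "card (nb x) \<le> Max ?D" if "x \<in> pverts G" for x using that by (intro Max_ge) auto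
    ultimately show ?thesis using that by (metis (no_types, lifting) imageE)
  qed
  have "x \<in> insert w (nb w)" if x: "x \<in> pverts G" for x
  proof (rule ccontr)
    assume out: "x \<notin> insert w (nb w)"
    \<comment> \<open>Otherwise the closed neighbourhood of \<open>w\<close> would be closed under
      arcs and, by connectedness, contain \<open>x\<close>.\<close>
    have "\<exists>c y. c \<in> insert w (nb w) \<and> y \<notin> insert w (nb w) \<and> (c, y) \<in> parcs G"
    proof (rule ccontr)
      assume no: "\<not> ?thesis"
      have "z \<in> insert w (nb w)" if "(w, z) \<in> (parcs G)\<^sup>*" for z
        using that by (induction rule: rtrancl_induct) (use no in blast)+
      then show False using reach[OF w x] out by blast
    qed
    then obtain c y where c: "c \<in> insert w (nb w)" and y: "y \<notin> insert w (nb w)" and cy: "(c, y) \<in> parcs G"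
      by blast
    have wc: "(w, c) \<in> parcs G" using c y cy by (auto simp: nb_def)
    have neq: "w \<noteq> c" "w \<noteq> y" using wc y pair_graph_irrefl[OF G] by auto
    have cV: "c \<in> pverts G" using pair_graph_in_verts[OF G wc] by simp
    have "y \<in> private_nbrs G c w" using cy y by (auto simp: private_nbrs_def nb_def)
    then have "private_nbrs G w c = {}"
      using nested w cV neq wc unfolding locally_nested_def by blast
    then have "insert w (insert y (nb w - {c})) \<subseteq> nb c"
      using cy wc pair_graph_sym[OF G] by (auto simp: private_nbrs_def nb_def)
    then have "card (insert w (insert y (nb w - {c}))) \<le> card (nb c)"
      by (rule card_mono[OF fin])
    moreover have "card (insert w (insert y (nb w - {c}))) = Suc (Suc (card (nb w - {c})))"
      using y neq pair_graph_irrefl[OF G] fin by (auto simp: nb_def)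
    moreover have "card (nb w) = Suc (card (nb w - {c}))"
      using wc card_Suc_Diff1[OF fin, of c w] by (simp add: nb_def)
    ultimately show False using max[OF cV] by simp
  qed
  then show ?thesis using that[OF w] by (auto simp: nb_def)
qed

text \<open>This is the shape in which a locally nested bicyclic graph is recognised: a star at the
  dominating vertex plus two edges with a common end.\<close>

lemma parcs_Y_graph_star:
  assumes "4 \<le> n"
  shows "parcs (Y_graph n) = {0} \<times> {1..<n} \<union> {1..<n} \<times> {0} \<union> {(1, 2), (2, 1), (1, 3), (3, 1)}"
proof -
  have "{1..<n} = {1, 2, 3} \<union> {4..<n}" using assms by auto
  moreover have "parcs (theta_graph 2 2 1) =
        {(0, 1), (1, 0), (0, 2), (2, 0), (0, 3), (3, 0), (1, 2), (2, 1), (1, 3), (3, 1)}"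
      unfolding theta_graph_2_2_1 by auto
  ultimately show ?thesis unfolding parcs_Y_graph by auto
qed

text \<open>The dominating vertex \<open>w\<close> uses \<open>n - 1\<close> of the
  \<open>n + 1\<close> edges, which leaves two. Were these disjoint, an end of one and an end of the
  other would have \<open>w\<close> as common neighbour and their opposite ends as private
  neighbours, against nestedness. So they form a path with middle vertex \<open>a\<close>, and
  \<open>G\<close> is a star with this path added.\<close>

lemma locally_nested_bicyclic_iso_Y_graph:
  assumes G: "bicyclic G" and nested: "locally_nested G" and n: "card (pverts G) = n"
  shows "digraph_iso (with_proj G) (with_proj (Y_graph n))"
proof -
  have pg: "pair_graph G" and conn: "Digraph_Component.connected (with_proj G)"
    and m: "card (uedges G) = n + 1"
    using G n by (auto simp: bicyclic_def)
  interpret pair_graph G by fact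
  obtain w where w: "w \<in> pverts G" and dom: "\<And>x. x \<in> pverts G \<Longrightarrow> x \<noteq> w \<Longrightarrow> (w, x) \<in> parcs G"
    by (rule locally_nested_dominating[OF pg conn nested]) blast
  let ?V = "pverts G"
  note sym = pair_graph_sym[OF pg] and irr = pair_graph_irrefl[OF pg] and inV = pair_graph_in_verts[OF pg]
  note ue = doubleton_in_uedges_iff[OF pg]
  define R where "R = {e \<in> uedges G. w \<notin> e}"
  let ?S = "(\<lambda>x. {w, x}) ` (?V - {w})"
  have split: "uedges G = ?S \<union> R"
  proof (intro Set.set_eqI iffI)
    fix e assume e: "e \<in> uedges G"
    then obtain x y where "e = {x, y}" "(x, y) \<in> parcs G" by (rule uedgesE)
    then show "e \<in> ?S \<union> R" using e inV irr by (auto simp: R_def insert_commute)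
  next
    fix e assume "e \<in> ?S \<union> R"
    then show "e \<in> uedges G" using dom ue by (auto simp: R_def)
  qed
  have finR: "finite R" using finite_uedges[OF pg] by (simp add: R_def)
  have "card ?S = n - 1"
    using w n by (subst card_image) (auto simp: inj_on_def doubleton_eq_iff)
  moreover have "card (?S \<union> R) = card ?S + card R"
    by (rule card_Un_disjoint) (use finR in \<open>auto simp: R_def\<close>)
  moreover have "n \<ge> 1" using w n card_gt_0_iff[of ?V] by auto
  ultimately have "card R = 2" using m split by simp
  then obtain e1 e2 where R: "R = {e1, e2}" and ne: "e1 \<noteq> e2" by (auto simp: card_2_iff)
  have e12: "e1 \<in> uedges G" "e2 \<in> uedges G" and notw: "w \<notin> e1" "w \<notin> e2"
    using R unfolding R_def by blast+
  obtain a' b' where e1: "e1 = {a', b'}" "(a', b') \<in> parcs G" using e12(1) by (rule uedgesE)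
  obtain c' d' where e2: "e2 = {c', d'}" "(c', d') \<in> parcs G" using e12(2) by (rule uedgesE)
  \<comment> \<open>Away from \<open>w\<close>, adjacency is decided by the two leftover edges
    alone.\<close>
  have Redge: "(x, y) \<in> parcs G \<longleftrightarrow> {x, y} = e1 \<or> {x, y} = e2" if "x \<noteq> w" "y \<noteq> w" for x y
  proof -
    have "(x, y) \<in> parcs G \<longleftrightarrow> {x, y} \<in> R" using that by (simp add: ue R_def)
    then show ?thesis by (simp add: R)
  qed
  have "e1 \<inter> e2 \<noteq> {}"
  proof
    assume disj: "e1 \<inter> e2 = {}"
    then have d: "a' \<noteq> c'" "a' \<noteq> d'" "b' \<noteq> c'" "b' \<noteq> d'" using e1 e2 by auto
    have V: "a' \<in> ?V" "c' \<in> ?V" using e1 e2 inV by auto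
    have w': "a' \<noteq> w" "b' \<noteq> w" "c' \<noteq> w" "d' \<noteq> w" using notw e1 e2 by auto
    have "b' \<in> private_nbrs G a' c'" "d' \<in> private_nbrs G c' a'"
      using e1 e2 d w' Redge[of c' b'] Redge[of a' d'] irr by (auto simp: private_nbrs_def doubleton_eq_iff)
    moreover have "(a', w) \<in> parcs G" "(c', w) \<in> parcs G" using dom V w' sym by blast+
    ultimately show False using nested V d unfolding locally_nested_def by blast
  qed
  then obtain a where a: "a \<in> e1" "a \<in> e2" by blast
  obtain b where ab: "e1 = {a, b}" using a(1) e1(1) by (metis insertE insert_commute singletonD)
  obtain c where ac: "e2 = {a, c}" using a(2) e2(1) by (metis insertE insert_commute singletonD)
  have bc: "b \<noteq> c" using ne ab ac by auto
  have arcs: "(a, b) \<in> parcs G" "(a, c) \<in> parcs G" using e12 ue unfolding ab ac by auto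
  have V: "a \<in> ?V" "b \<in> ?V" "c \<in> ?V" using arcs inV by auto
  have d: "a \<noteq> b" "a \<noteq> c" using arcs irr by auto
  have dw: "a \<noteq> w" "b \<noteq> w" "c \<noteq> w" using notw ab ac by auto
  have E: "parcs G = {w} \<times> (?V - {w}) \<union> (?V - {w}) \<times> {w} \<union> {(a, b), (b, a), (a, c), (c, a)}"
  proof (rule Set.set_eqI)
    fix p :: "'a \<times> 'a"
    obtain x y where p: "p = (x, y)" by (cases p)
    show "p \<in> parcs G \<longleftrightarrow> p \<in> {w} \<times> (?V - {w}) \<union> (?V - {w}) \<times> {w} \<union> {(a, b), (b, a), (a, c), (c, a)}"
    proof (cases "x = w \<or> y = w")
      case True
      moreover have "(z, w) \<in> parcs G" if "z \<in> ?V" "z \<noteq> w" for z using dom[OF that] sym by blast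
      ultimately show ?thesis using p dom inV irr dw by auto
    next
      case False
      then show ?thesis using p Redge[of x y] ab ac by (auto simp: doubleton_eq_iff)
    qed
  qed
  define S where "S = ?V - {w, a, b, c}"
  have VS: "?V = {w, a, b, c} \<union> S" and VS': "?V - {w} = {a, b, c} \<union> S"
    using V w dw by (auto simp: S_def)
  have card4: "card {w, a, b, c} = 4" using d dw bc by auto
  have "card S = n - 4" using n V w card4 by (simp add: S_def card_Diff_subset)
  moreover have n4: "4 \<le> n" using card_mono[of ?V "{w, a, b, c}"] V w card4 n by simp
  ultimately have "\<exists>h. bij_betw h S {4..<n}"
    by (intro finite_same_card_bij) (auto simp: S_def)
  then obtain h where h: "bij_betw h S {4..<n}" by blast
  \<comment> \<open>The dominating vertex goes to 0, the middle of the path to 1 and its ends to 2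
    and 3, as in \<open>parcs_Y_graph_star\<close>; \<open>h\<close> numbers the pendent
    vertices.\<close>
  define f where "f x = (if x = w then 0 else if x = a then 1 else if x = b then 2 else if x = c then 3 else h x)" for x
  have f4: "f w = 0" "f a = 1" "f b = 2" "f c = 3" using d dw bc by (auto simp: f_def)
  have fS: "f x = h x" if "x \<in> S" for x using that by (auto simp: f_def S_def)
  then have fS': "f ` S = {4..<n}" using h by (simp add: bij_betw_def)
  have fV': "f ` (?V - {w}) = {1..<n}" unfolding VS' image_Un fS' using f4 n4 by auto
  have fV: "f ` ?V = {0..<n}" unfolding VS image_Un fS' using f4 n4 by auto
  \<comment> \<open>A map onto a finite set of the same size as its domain is injective, so the
    cases of \<open>f\<close> need no inspection.\<close>
  have inj: "inj_on f ?V" by (rule eq_card_imp_inj_on) (simp_all add: fV n)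
  show ?thesis
  proof (rule digraph_iso_pairI[OF pg inj])
    show "pverts (Y_graph n) = f ` ?V" by (simp add: fV pverts_Y_graph[OF n4])
    show "parcs (Y_graph n) = map_prod f f ` parcs G"
      unfolding parcs_Y_graph_star[OF n4] E image_Un image_insert map_prod_surj_on[OF refl refl] fV'
      by (simp add: f4 del: One_nat_def)
  qed
qed

section \<open>Maximisers on a fixed vertex set\<close>

definition bicyclic_maximal :: "'a pair_pre_digraph \<Rightarrow> bool" where
  "bicyclic_maximal G \<longleftrightarrow> bicyclic G \<and>
     (\<forall>H. bicyclic H \<longrightarrow> pverts H = pverts G \<longrightarrow> resolvent_energy H \<le> resolvent_energy G)"

lemma bicyclic_maximal_iso_Y_graph:
  assumes "bicyclic_maximal G"
  shows "digraph_iso (with_proj G) (with_proj (Y_graph (card (pverts G))))"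
proof (rule locally_nested_bicyclic_iso_Y_graph)
  show G: "bicyclic G" using assms by (simp add: bicyclic_maximal_def)
  show "locally_nested G"
    unfolding locally_nested_def
  proof (intro ballI impI)
    fix u v assume uv: "u \<in> pverts G" "v \<in> pverts G" "u \<noteq> v"
      and near: "(u, v) \<in> parcs G \<or> (\<exists>c. (u, c) \<in> parcs G \<and> (v, c) \<in> parcs G)"
    \<comment> \<open>The adjacency or common neighbour assumed in \<open>locally_nested\<close>
      keeps the transform bicyclic, and its vertex set is that of \<open>G\<close>, so maximality
      applies to it.\<close>
    have "resolvent_energy (kelmans G u v) \<le> resolvent_energy G"
      using assms bicyclic_kelmans[OF G uv near] by (simp add: bicyclic_maximal_def)
    then show "private_nbrs G u v = {} \<or> private_nbrs G v u = {}"
      using resolvent_energy_kelmans_less[OF _ uv] G by (auto simp: bicyclic_def not_less[symmetric])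
  qed
qed simp

text \<open>Some bicyclic graph on the vertex set of \<open>G\<close> attains the maximum, and every
  maximiser is isomorphic to \<open>Y_graph n\<close>. So the maximum is the resolvent energy of
  \<open>Y_graph n\<close>, and if \<open>G\<close> reaches it then \<open>G\<close> is itself a
  maximiser.\<close>

theorem theorem8:
  fixes G :: "'a pair_pre_digraph" and n :: nat
  assumes "5 \<le> n" and "bicyclic G" and "card (pverts G) = n"
  shows "resolvent_energy G \<le> resolvent_energy (Y_graph n)
    \<and> (resolvent_energy G = resolvent_energy (Y_graph n)
         \<longleftrightarrow> digraph_iso (with_proj G) (with_proj (Y_graph n)))"
proof -
  have pg: "pair_graph G" using assms by (simp add: bicyclic_def)
  interpret pair_graph G by fact
  let ?B = "{H. bicyclic H \<and> pverts H = pverts G}"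
  \<comment> \<open>Fixing the vertex set leaves finitely many arc sets, so the maximum is
    attained.\<close>
  have "?B \<subseteq> (\<lambda>E. \<lparr> pverts = pverts G, parcs = E \<rparr>) ` Pow (pverts G \<times> pverts G)"
  proof
    fix H assume "H \<in> ?B"
    then have "parcs H \<subseteq> pverts G \<times> pverts G" and V: "pverts H = pverts G"
      using pair_graph_in_verts[of H] by (auto simp: bicyclic_def)
    moreover have "H = \<lparr> pverts = pverts G, parcs = parcs H \<rparr>" using V by (cases H) simp
    ultimately show "H \<in> (\<lambda>E. \<lparr> pverts = pverts G, parcs = E \<rparr>) ` Pow (pverts G \<times> pverts G)" by blast
  qed
  then have fin: "finite ?B" by (rule finite_subset) simp
  obtain H where H: "H \<in> ?B" and max: "\<And>H'. H' \<in> ?B \<Longrightarrow> resolvent_energy H' \<le> resolvent_energy H"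
  proof -
    have "resolvent_energy ` ?B \<noteq> {}" "finite (resolvent_energy ` ?B)" using assms fin by auto
    then have "Max (resolvent_energy ` ?B) \<in> resolvent_energy ` ?B"
      "\<And>H'. H' \<in> ?B \<Longrightarrow> resolvent_energy H' \<le> Max (resolvent_energy ` ?B)"
      by (auto intro: Max_in)
    then show ?thesis using that by (metis (no_types, lifting) imageE)
  qed
  have "bicyclic_maximal H" using H max by (auto simp: bicyclic_maximal_def)
  \<comment> \<open>\<open>Y_graph n\<close> lives on the natural numbers rather than on the
    vertices of \<open>G\<close>; its energy enters only through the isomorphism with the maximiser
    \<open>H\<close>.\<close>
  then have HY: "resolvent_energy H = resolvent_energy (Y_graph n)"
    using bicyclic_maximal_iso_Y_graph[of H] resolvent_energy_iso H assms(3) by (auto simp: bicyclic_def)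
  have le: "resolvent_energy G \<le> resolvent_energy (Y_graph n)"
    using max[of G] assms HY by simp
  have "digraph_iso (with_proj G) (with_proj (Y_graph n))"
    if "resolvent_energy G = resolvent_energy (Y_graph n)"
  proof -
    have "bicyclic_maximal G" using that max HY assms(2) by (auto simp: bicyclic_maximal_def)
    then show ?thesis using bicyclic_maximal_iso_Y_graph assms(3) by blast
  qed
  then show ?thesis using le resolvent_energy_iso[OF pg] by blast
qed

end
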